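(* The continuous density $f$ of the limiting Quicksort random variable $Y$ satisfies $\max_{x\in\mathbb{R}} f(x)<16$ and $\max_{x\in\mathbb{R}}|f'(x)|<2466$.
   Context: Let $g(u):=2u\ln u+2(1-u)\ln(1-u)+1$ for $u\in(0,1)$. The limiting Quicksort random variable $Y$ is the limit in distribution of $(X_n-\mathbf{E}X_n)/n$, where $X_n$ is the number of comparisons used by randomized Quicksort on $n$ distinct numbers; equivalently, its law is the unique law with $\mathbf{E}Y=0$ and finite variance satisfying $Y\overset{d}{=}UY+(1-U)Z+g(U)$, where on the right $U,Y,Z$ are independent, $Z\overset{d}{=}Y$ and $U$ is uniform on $(0,1)$. $Y$ has a continuous (indeed infinitely differentiable) density $f$. *)

theory Defs
  imports "HOL-Probability.Probability"
begin

definition qs_g :: "real \<Rightarrow> real" where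
  "qs_g u = 2 * u * ln u + 2 * (1 - u) * ln (1 - u) + 1"

definition qs_map :: "real measure \<Rightarrow> real measure" where
  "qs_map \<mu> = distr (uniform_measure lborel {0<..<1} \<Otimes>\<^sub>M (\<mu> \<Otimes>\<^sub>M \<mu>)) borel
      (\<lambda>(u, y, z). u * y + (1 - u) * z + qs_g u)"

definition is_qs_law :: "real measure \<Rightarrow> bool" where
  "is_qs_law \<mu> \<longleftrightarrow> prob_space \<mu> \<and> sets \<mu> = sets borel \<and>
     integrable \<mu> (\<lambda>x. x) \<and> integral\<^sup>L \<mu> (\<lambda>x. x) = 0 \<and>
     integrable \<mu> (\<lambda>x. x\<^sup>2) \<and> qs_map \<mu> = \<mu>"

definition quicksort_law :: "real measure" where
  "quicksort_law = (THE \<mu>. is_qs_law \<mu>)"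

end

theory Submission
  imports Defs
begin

text \<open>
  The characteristic function \<open>\<chi>\<close> of a fixed point of the Quicksort map satisfies
  \<open>\<chi> t = \<integral>\<^sub>0\<^sup>1 \<chi> (u t) \<chi> ((1 - u) t) exp (i t g u) du\<close>.
  On characteristic functions of centred laws with finite variance this map is a contraction with
  factor \<open>2/3\<close> for the metric \<open>sup \<bar>\<chi>\<^sub>1 t - \<chi>\<^sub>2 t\<bar> / t\<^sup>2\<close>, because \<open>u\<^sup>2 + (1 - u)\<^sup>2\<close> has
  mean \<open>2/3\<close>; with tightness this gives existence and uniqueness of the law.

  Conditioning on the two subproblems leaves an oscillatory integral in \<open>u\<close> whose phase has second
  derivative at least \<open>8 t\<close>, so a sharpened van der Corput estimate gives
  \<open>\<bar>\<chi> t\<bar> \<le> sqrt (2 / t)\<close>. Since \<open>\<bar>\<chi>\<bar>\<close> is bounded by its self-convolution, this improves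
  successively to explicit bounds of order \<open>t\<^sup>-\<^sup>1\<close>, \<open>t\<^sup>-\<^sup>3\<^sup>/\<^sup>2\<close> and \<open>t\<^sup>-\<^sup>5\<^sup>/\<^sup>2\<close>, whence
  \<open>\<integral> \<bar>\<chi>\<bar> \<le> 80 < 32 pi\<close> and \<open>\<integral> \<bar>t\<bar> \<bar>\<chi> t\<bar> \<le> 8108 < 4932 pi\<close>. Fourier inversion yields
  the two bounds, and the Riemann-Lebesgue lemma shows that the maxima are attained.
\<close>

section \<open>The Quicksort map on characteristic functions\<close>

abbreviation unif :: "real measure" where
  "unif \<equiv> uniform_measure lborel {0<..<1}"

interpretation unif: real_distribution unif
proof -
  have "prob_space unif" by (rule prob_space_uniform_measure) auto
  then show "real_distribution unif"
    by (auto simp: real_distribution_def real_distribution_axioms_def)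
qed

lemma AE_unif: "(\<And>u. 0 < u \<Longrightarrow> u < 1 \<Longrightarrow> P u) \<Longrightarrow> AE u in unif. P u"
  by (rule AE_uniform_measureI) auto

lemma integrable_unif:
  fixes h :: "real \<Rightarrow> 'a::{banach, second_countable_topology}"
  assumes "h \<in> borel_measurable borel" "\<And>u. 0 < u \<Longrightarrow> u < 1 \<Longrightarrow> norm (h u) \<le> B"
  shows "integrable unif h"
  by (rule unif.integrable_const_bound[where B = B])
    (use assms in \<open>auto intro!: AE_unif simp: measurable_cong_sets[OF unif.events_eq_borel refl]\<close>)

text \<open>Bridges the two integrals in use: laws and Fubini need the Bochner integral, while the
  fundamental theorem of calculus and integration by parts work with the gauge integral over a
  closed interval. The endpoints form a negligible set.\<close>

lemma integral_unif:
  fixes h :: "real \<Rightarrow> 'a::euclidean_space"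
  assumes m: "h \<in> borel_measurable borel" and "\<And>u. 0 < u \<Longrightarrow> u < 1 \<Longrightarrow> norm (h u) \<le> B"
  shows "(\<integral>u. h u \<partial>unif) = integral {0..1} h"
    and "h absolutely_integrable_on {0..1}"
proof -
  have unif_eq: "unif = density lborel (\<lambda>u. ennreal (indicator {0<..<1} u))"
    by (simp add: uniform_measure_def divide_ennreal_def ennreal_indicator)
  have "integrable unif h" by (rule integrable_unif[OF assms])
  then have i: "set_integrable lborel {0<..<1} h"
    unfolding unif_eq set_integrable_def using m by (subst (asm) integrable_density) auto
  have "(\<integral>u. h u \<partial>unif) = (LINT u:{0<..<1}|lborel. h u)"
    unfolding unif_eq set_lebesgue_integral_def using m by (subst integral_density) auto
  also have "\<dots> = integral {0<..<1} h" by (rule set_borel_integral_eq_integral(2)[OF i])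
  also have "\<dots> = integral {0..1} h" by (simp add: integral_open_interval_real)
  finally show "(\<integral>u. h u \<partial>unif) = integral {0..1} h" .
  have "set_integrable lebesgue {0<..<1} h"
    using i unfolding set_integrable_def
    by (subst integrable_completion) (use m in measurable)
  moreover have "negligible {x \<in> {0<..<1} - {0..1}. h x \<noteq> 0}" "negligible {x \<in> {0..1} - {0<..<1}. h x \<noteq> 0}"
    by (rule negligible_subset[of "{0, 1::real}"]; force simp: negligible_insert)+
  ultimately show "h absolutely_integrable_on {0..1}"
    by (rule absolutely_integrable_spike_set)
qed

section \<open>Size and mean of the toll function\<close>

lemma qs_g_measurable [measurable]: "qs_g \<in> borel_measurable borel"
  unfolding qs_g_def[abs_def] by measurable

lemma x_ln_x_ge: "0 < (x::real) \<Longrightarrow> x - 1 \<le> x * ln x"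
  using ln_le_minus_one[of "1/x"] by (simp add: ln_div field_simps)

text \<open>The products \<open>u * ln u\<close> and \<open>(1 - u) * ln (1 - u)\<close> lie in
  [u - 1, 0] and [-u, 0], so their sum lies in [-1, 0].\<close>

lemma abs_qs_g_le: "\<bar>qs_g u\<bar> \<le> 1" if "0 < u" "u < 1"
proof -
  have "u * ln u \<le> 0" "(1 - u) * ln (1 - u) \<le> 0"
    using that by (auto intro!: mult_nonneg_nonpos)
  moreover have "u - 1 \<le> u * ln u" "- u \<le> (1 - u) * ln (1 - u)"
    using x_ln_x_ge[of u] x_ln_x_ge[of "1 - u"] that by auto
  moreover have "qs_g u = 2 * (u * ln u) + 2 * ((1 - u) * ln (1 - u)) + 1"
    by (simp add: qs_g_def)
  ultimately show ?thesis by linarith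
qed

text \<open>Supplies continuity up to the endpoints for the antiderivative of \<open>qs_g\<close>.
  Only 0 is critical, and there the bound 1 on the modulus of \<open>x * ln x\<close> leaves a
  factor x.\<close>

lemma continuous_on_square_ln: "continuous_on {0..1} (\<lambda>x::real. x\<^sup>2 * ln x)"
proof (subst continuous_on_eq_continuous_within, intro ballI)
  fix x :: real assume x: "x \<in> {0..1}"
  show "continuous (at x within {0..1}) (\<lambda>x. x\<^sup>2 * ln x)"
  proof (cases "x = 0")
    case False
    then show ?thesis by (auto intro!: continuous_intros)
  next
    case True
    have "((\<lambda>x. x\<^sup>2 * ln x) \<longlongrightarrow> 0) (at 0 within {0..1::real})"
    proof (rule Lim_null_comparison)
      show "eventually (\<lambda>x::real. norm (x\<^sup>2 * ln x) \<le> x) (at 0 within {0..1})"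
      proof (unfold eventually_at_filter, rule always_eventually, intro allI impI)
        fix x :: real assume "x \<noteq> 0" "x \<in> {0..1}"
        then have x: "0 < x" "x \<le> 1" by auto
        have "\<bar>x * ln x\<bar> \<le> 1"
          using x_ln_x_ge[of x] x mult_nonneg_nonpos[of x "ln x"] by simp
        then have "x * \<bar>x * ln x\<bar> \<le> x * 1" using x by (intro mult_left_mono) auto
        then show "norm (x\<^sup>2 * ln x) \<le> x" using x by (simp add: power2_eq_square abs_mult)
      qed
    qed (auto intro!: tendsto_intros)
    with True show ?thesis by (simp add: continuous_within)
  qed
qed

lemma has_integral_qs_g: "(qs_g has_integral 0) {0..1}"
proof -
  \<comment> \<open>Termwise antiderivative: 2 u ln u integrates to u^2 ln u - u^2 / 2, and the
    second summand is its reflection under u to 1 - u with the sign reversed. Both endpoint values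
    are 1/2.\<close>
  let ?G = "\<lambda>u::real. u\<^sup>2 * ln u - u\<^sup>2 / 2 - (1-u)\<^sup>2 * ln (1-u) + (1-u)\<^sup>2 / 2 + u"
  have c2: "continuous_on {0..1} (\<lambda>u::real. (1-u)\<^sup>2 * ln (1-u))"
    by (rule continuous_on_compose2[OF continuous_on_square_ln]) (auto intro!: continuous_intros)
  have "(qs_g has_integral ?G 1 - ?G 0) {0..1}"
  proof (rule fundamental_theorem_of_calculus_interior)
    show "continuous_on {0..1} ?G"
      by (intro continuous_intros continuous_on_square_ln c2) auto
    fix u :: real assume u: "u \<in> {0<..<1}"
    have d: "((\<lambda>v::real. v\<^sup>2 * ln v) has_real_derivative 2 * v * ln v + v) (at v)" if "0 < v" for v
      using that by (auto intro!: derivative_eq_intros simp: field_simps power2_eq_square)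
    have d2: "((\<lambda>u::real. (1-u)\<^sup>2 * ln (1-u)) has_real_derivative
        (2 * (1-u) * ln (1-u) + (1-u)) * (- 1)) (at u)"
      by (rule DERIV_chain2[OF d]) (use u in \<open>auto intro!: derivative_eq_intros\<close>)
    show "(?G has_vector_derivative qs_g u) (at u)"
      unfolding has_real_derivative_iff_has_vector_derivative[symmetric] qs_g_def
      by (rule DERIV_cong, rule DERIV_add[OF DERIV_add[OF DERIV_diff[OF DERIV_diff[OF d] d2]] DERIV_ident])
        (use u in \<open>auto intro!: derivative_eq_intros simp: field_simps\<close>)
  qed auto
  then show ?thesis by simp
qed

lemma expectation_qs_g: "(\<integral>u. qs_g u \<partial>unif) = 0"
proof -
  have "(\<integral>u. qs_g u \<partial>unif) = integral {0..1} qs_g"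
    by (rule integral_unif(1)[where B = 1]) (simp_all add: abs_qs_g_le)
  then show ?thesis using has_integral_qs_g by (simp add: integral_unique)
qed

lemma expectation_unif_squares: "(\<integral>u. u\<^sup>2 + (1-u)\<^sup>2 \<partial>unif) = 2/3"
proof -
  let ?F = "\<lambda>u::real. u^3/3 - (1-u)^3/3"
  have *: "((\<lambda>u::real. u\<^sup>2 + (1-u)\<^sup>2) has_integral ?F 1 - ?F 0) {0..1}"
    by (rule fundamental_theorem_of_calculus)
      (auto intro!: derivative_eq_intros simp: has_real_derivative_iff_has_vector_derivative[symmetric])
  have "(\<integral>u. u\<^sup>2 + (1-u)\<^sup>2 \<partial>unif) = integral {0..1} (\<lambda>u. u\<^sup>2 + (1-u)\<^sup>2)"
  proof (rule integral_unif(1)[where B = 2])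
    fix u :: real assume "0 < u" "u < 1"
    then have "u\<^sup>2 \<le> 1" "(1-u)\<^sup>2 \<le> 1" by (auto simp: power_le_one)
    then show "norm (u\<^sup>2 + (1-u)\<^sup>2) \<le> 2" by simp
  qed auto
  then show ?thesis using integral_unique[OF *] by simp
qed

section \<open>Fubini and contraction for the Quicksort map\<close>

lemma real_distribution_qs_map:
  assumes "real_distribution M"
  shows "real_distribution (qs_map M)"
proof -
  interpret real_distribution M by fact
  interpret MM: pair_prob_space M M ..
  interpret UMM: pair_prob_space unif "M \<Otimes>\<^sub>M M" ..
  have "prob_space (qs_map M)"
    unfolding qs_map_def by (rule UMM.prob_space_distr) measurable
  then show ?thesis
    by (auto simp: real_distribution_def real_distribution_axioms_def qs_map_def)
qed

text \<open>Fubini in both orders. Integrating out the two subproblems first gives the product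
  formula behind the contraction and the self-convolution bound; integrating over u first gives the
  oscillatory integral for the van der Corput estimate.\<close>

lemma char_qs_map:
  assumes "real_distribution M"
  shows "char (qs_map M) t = (\<integral>u. char M (u*t) * char M ((1-u)*t) * iexp (t * qs_g u) \<partial>unif)"
    and "char (qs_map M) t =
      (\<integral>p. (\<integral>u. iexp (t * (u * fst p + (1-u) * snd p + qs_g u)) \<partial>unif) \<partial>(M \<Otimes>\<^sub>M M))"
proof -
  interpret real_distribution M by fact
  interpret MM: pair_prob_space M M ..
  interpret UMM: pair_prob_space unif "M \<Otimes>\<^sub>M M" ..
  let ?e = "\<lambda>u p. iexp (t * (u * fst p + (1-u) * snd p + qs_g u))"
  have int: "integrable (unif \<Otimes>\<^sub>M (M \<Otimes>\<^sub>M M)) (\<lambda>(u, p). ?e u p)"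
    by (rule UMM.integrable_const_bound[where B = 1]) (auto simp: norm_exp_i_times simp del: of_real_mult of_real_add)
  have c: "char (qs_map M) t = (\<integral>x. (case x of (u, p) \<Rightarrow> ?e u p) \<partial>(unif \<Otimes>\<^sub>M (M \<Otimes>\<^sub>M M)))"
    unfolding char_def qs_map_def case_prod_beta
    by (subst integral_distr) auto
  show "char (qs_map M) t = (\<integral>p. (\<integral>u. ?e u p \<partial>unif) \<partial>(M \<Otimes>\<^sub>M M))"
    unfolding c by (rule UMM.integral_snd[OF int, symmetric])
  have inner: "(\<integral>p. ?e u p \<partial>(M \<Otimes>\<^sub>M M)) = char M (u*t) * char M ((1-u)*t) * iexp (t * qs_g u)" for u
  proof -
    have "(\<integral>p. ?e u p \<partial>(M \<Otimes>\<^sub>M M)) = (\<integral>p. (case p of (y, z) \<Rightarrow> ?e u (y, z)) \<partial>(M \<Otimes>\<^sub>M M))"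
      by (simp add: case_prod_beta)
    also have "\<dots> = (\<integral>y. (\<integral>z. ?e u (y, z) \<partial>M) \<partial>M)"
      by (rule MM.integral_fst[symmetric], rule MM.integrable_const_bound[where B = 1])
        (auto simp: norm_exp_i_times simp del: of_real_mult of_real_add)
    also have "\<dots> = (\<integral>y. (\<integral>z. (iexp ((u*t)*y) * iexp (t * qs_g u)) * iexp (((1-u)*t)*z) \<partial>M) \<partial>M)"
    proof (intro Bochner_Integration.integral_cong refl)
      fix y z
      have "t * (u * y + (1-u) * z + qs_g u) = (u*t)*y + t * qs_g u + ((1-u)*t)*z"
        by (simp add: algebra_simps)
      then show "?e u (y, z) = (iexp ((u*t)*y) * iexp (t * qs_g u)) * iexp (((1-u)*t)*z)"
        by (simp only: fst_conv snd_conv exp_add[symmetric] distrib_left[symmetric] of_real_add[symmetric])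
    qed
    also have "\<dots> = char M (u*t) * char M ((1-u)*t) * iexp (t * qs_g u)"
      by (simp add: char_def del: of_real_mult)
    finally show ?thesis .
  qed
  show "char (qs_map M) t = (\<integral>u. char M (u*t) * char M ((1-u)*t) * iexp (t * qs_g u) \<partial>unif)"
    unfolding c UMM.integral_fst[OF int, symmetric] inner ..
qed

lemma norm_lebesgue_integral_le_AE:
  fixes h :: "'a \<Rightarrow> 'b::{banach, second_countable_topology}"
  assumes "integrable M h" "integrable M w" "AE x in M. norm (h x) \<le> w x"
  shows "norm (\<integral>x. h x \<partial>M) \<le> (\<integral>x. w x \<partial>M)"
  by (rule order_trans[OF integral_norm_bound integral_mono_AE]) (use assms in auto)

lemma integrable_unif_squares: "integrable unif (\<lambda>u. u\<^sup>2 + (1-u)\<^sup>2)"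
proof (rule integrable_unif[where B = 2])
  fix u :: real assume "0 < u" "u < 1"
  then have "u\<^sup>2 \<le> 1" "(1-u)\<^sup>2 \<le> 1" by (auto simp: power_le_one)
  then show "norm (u\<^sup>2 + (1-u)\<^sup>2) \<le> 2" by simp
qed auto

lemma sum_squares_scale:
  fixes D u t :: real
  shows "D * (u*t)\<^sup>2 + D * ((1-u)*t)\<^sup>2 = D * t\<^sup>2 * (u\<^sup>2 + (1-u)\<^sup>2)"
  unfolding power2_eq_square by (simp add: algebra_simps)

lemma norm_mult_diff_le:
  fixes a b c d :: "'a::real_normed_field"
  shows "norm (a * b - c * d) \<le> norm (a - c) * norm b + norm c * norm (b - d)"
proof -
  have "a * b - c * d = (a - c) * b + c * (b - d)" by (simp add: algebra_simps)
  then show ?thesis by (metis norm_mult norm_triangle_ineq)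
qed

text \<open>Replacing one factor of the product at a time, with all other factors of modulus at most
  1, costs D (u t)^2 + D ((1-u) t)^2. The mean over u produces the factor 2/3.\<close>

lemma char_qs_map_diff:
  assumes "real_distribution M" "real_distribution N"
    and D: "\<And>t. cmod (char M t - char N t) \<le> D * t\<^sup>2"
  shows "cmod (char (qs_map M) t - char (qs_map N) t) \<le> 2/3 * D * t\<^sup>2"
proof -
  interpret M: real_distribution M by fact
  interpret N: real_distribution N by fact
  let ?f = "\<lambda>M u. char M (u*t) * char M ((1-u)*t) * iexp (t * qs_g u)"
  have le1: "cmod (char M s) \<le> 1" "cmod (char N s) \<le> 1" for s
    by (rule M.cmod_char_le_1 N.cmod_char_le_1)+
  have iM: "integrable unif (?f M)" and iN: "integrable unif (?f N)"
    by (auto intro!: integrable_unif[where B = 1] simp: norm_mult mult_le_one le1 simp del: of_real_mult)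
  have eq: "char (qs_map M) t - char (qs_map N) t = (\<integral>u. ?f M u - ?f N u \<partial>unif)"
    unfolding char_qs_map(1)[OF assms(1)] char_qs_map(1)[OF assms(2)]
    by (rule Bochner_Integration.integral_diff[symmetric, OF iM iN])
  have "cmod (char (qs_map M) t - char (qs_map N) t) \<le> (\<integral>u. D * t\<^sup>2 * (u\<^sup>2 + (1-u)\<^sup>2) \<partial>unif)"
    unfolding eq
  proof (rule norm_lebesgue_integral_le_AE)
    show "integrable unif (\<lambda>u. ?f M u - ?f N u)" using iM iN by simp
    show "integrable unif (\<lambda>u. D * t\<^sup>2 * (u\<^sup>2 + (1-u)\<^sup>2))"
      using integrable_unif_squares by simp
    show "AE u in unif. cmod (?f M u - ?f N u) \<le> D * t\<^sup>2 * (u\<^sup>2 + (1-u)\<^sup>2)"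
    proof (rule AE_I2)
      fix u
      have "?f M u - ?f N u = (char M (u*t) * char M ((1-u)*t) - char N (u*t) * char N ((1-u)*t)) * iexp (t * qs_g u)"
        by (simp only: left_diff_distrib)
      then have "cmod (?f M u - ?f N u) = cmod (char M (u*t) * char M ((1-u)*t) - char N (u*t) * char N ((1-u)*t))"
        by (simp only: norm_mult norm_exp_i_times mult_1_right)
      also have "\<dots> \<le> cmod (char M (u*t) - char N (u*t)) * cmod (char M ((1-u)*t))
          + cmod (char N (u*t)) * cmod (char M ((1-u)*t) - char N ((1-u)*t))"
        by (rule norm_mult_diff_le)
      also have "\<dots> \<le> cmod (char M (u*t) - char N (u*t)) * 1 + 1 * cmod (char M ((1-u)*t) - char N ((1-u)*t))"
        by (intro add_mono mult_mono le1) auto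
      also have "\<dots> \<le> D * (u*t)\<^sup>2 + D * ((1-u)*t)\<^sup>2"
        using D[of "u*t"] D[of "(1-u)*t"] by simp
      also have "\<dots> = D * t\<^sup>2 * (u\<^sup>2 + (1-u)\<^sup>2)"
        by (rule sum_squares_scale)
      finally show "cmod (?f M u - ?f N u) \<le> D * t\<^sup>2 * (u\<^sup>2 + (1-u)\<^sup>2)" .
    qed
  qed
  also have "\<dots> = D * t\<^sup>2 * (2/3)"
    by (rule trans[OF integral_mult_right_zero]) (simp only: expectation_unif_squares)
  finally show ?thesis by (simp add: mult_ac)
qed

text \<open>The constant \<open>3/2\<close> is the fixed point of \<open>K \<mapsto> 2/3 * K + 1/2\<close>.\<close>

lemma char_qs_map_minus_1:
  assumes "real_distribution M" and K: "\<And>t. cmod (char M t - 1) \<le> 3/2 * t\<^sup>2"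
  shows "cmod (char (qs_map M) t - 1) \<le> 3/2 * t\<^sup>2"
proof -
  interpret M: real_distribution M by fact
  let ?f = "\<lambda>u. char M (u*t) * char M ((1-u)*t) * iexp (t * qs_g u)"
  have le1: "cmod (char M s) \<le> 1" for s by (rule M.cmod_char_le_1)
  have iM: "integrable unif ?f"
    by (auto intro!: integrable_unif[where B = 1] simp: norm_mult mult_le_one le1 simp del: of_real_mult)
  have ig: "integrable unif qs_g"
    by (rule integrable_unif[where B = 1]) (auto simp: abs_qs_g_le)
  have ig': "integrable unif (\<lambda>u. \<i> * complex_of_real (t * qs_g u))"
    using ig by simp
  have "(\<integral>u. \<i> * complex_of_real (t * qs_g u) \<partial>unif) = \<i> * complex_of_real (\<integral>u. t * qs_g u \<partial>unif)"
    by (subst integral_mult_right_zero) (simp only: integral_complex_of_real)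
  then have z: "(\<integral>u. \<i> * complex_of_real (t * qs_g u) \<partial>unif) = 0"
    by (simp add: expectation_qs_g)
  \<comment> \<open>The linear term i t g(u) has mean 0 and may be subtracted for free; what is left
    of the exponential is then quadratic in t.\<close>
  have eq: "char (qs_map M) t - 1 = (\<integral>u. ?f u - 1 - \<i> * complex_of_real (t * qs_g u) \<partial>unif)"
    unfolding char_qs_map(1)[OF assms(1)] using iM ig' z unif.prob_space by simp
  have "cmod (char (qs_map M) t - 1) \<le> (\<integral>u. 3/2 * t\<^sup>2 * (u\<^sup>2 + (1-u)\<^sup>2) + t\<^sup>2/2 \<partial>unif)"
    unfolding eq
  proof (rule norm_lebesgue_integral_le_AE)
    show "integrable unif (\<lambda>u. ?f u - 1 - \<i> * complex_of_real (t * qs_g u))" using iM ig' by simp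
    show "integrable unif (\<lambda>u. 3/2 * t\<^sup>2 * (u\<^sup>2 + (1-u)\<^sup>2) + t\<^sup>2/2)"
      using integrable_unif_squares by simp
    show "AE u in unif. cmod (?f u - 1 - \<i> * complex_of_real (t * qs_g u))
        \<le> 3/2 * t\<^sup>2 * (u\<^sup>2 + (1-u)\<^sup>2) + t\<^sup>2/2"
    proof (rule AE_unif)
      fix u :: real assume u: "0 < u" "u < 1"
      let ?e = "iexp (t * qs_g u)" and ?p = "char M (u*t) * char M ((1-u)*t)"
      have "?f u - 1 - \<i> * complex_of_real (t * qs_g u) =
          (?p - 1 * 1) * ?e + (?e - 1 - \<i> * complex_of_real (t * qs_g u))"
        by (simp only: left_diff_distrib) simp
      also have "cmod \<dots> \<le> cmod ((?p - 1 * 1) * ?e) + cmod (?e - 1 - \<i> * complex_of_real (t * qs_g u))"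
        by (rule norm_triangle_ineq)
      also have "cmod ((?p - 1 * 1) * ?e) = cmod (?p - 1 * 1)"
        by (simp only: norm_mult norm_exp_i_times mult_1_right)
      also have "\<dots> \<le> cmod (char M (u*t) - 1) * cmod (char M ((1-u)*t)) + cmod (1::complex) * cmod (char M ((1-u)*t) - 1)"
        by (rule norm_mult_diff_le)
      finally have "cmod (?f u - 1 - \<i> * complex_of_real (t * qs_g u))
        \<le> cmod (char M (u*t) - 1) * cmod (char M ((1-u)*t)) + cmod (char M ((1-u)*t) - 1)
          + cmod (?e - 1 - \<i> * complex_of_real (t * qs_g u))" by simp
      also have "\<dots> \<le> cmod (char M (u*t) - 1) * 1 + cmod (char M ((1-u)*t) - 1) + (t * qs_g u)\<^sup>2 / 2"
        using iexp_approx1[of "t * qs_g u" 1]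
        by (intro add_mono mult_mono le1) (auto simp: fact_2 eval_nat_numeral diff_diff_eq)
      also have "\<dots> \<le> 3/2 * (u*t)\<^sup>2 + 3/2 * ((1-u)*t)\<^sup>2 + t\<^sup>2 / 2"
      proof -
        have "(qs_g u)\<^sup>2 \<le> 1" using abs_qs_g_le[OF u] by (simp add: abs_square_le_1)
        then have "(t * qs_g u)\<^sup>2 \<le> t\<^sup>2" by (simp add: power_mult_distrib mult_left_le)
        then show ?thesis using K[of "u*t"] K[of "(1-u)*t"] by simp
      qed
      also have "\<dots> = 3/2 * t\<^sup>2 * (u\<^sup>2 + (1-u)\<^sup>2) + t\<^sup>2/2"
        by (simp only: sum_squares_scale[of "3/2"])
      finally show "cmod (?f u - 1 - \<i> * complex_of_real (t * qs_g u))
        \<le> 3/2 * t\<^sup>2 * (u\<^sup>2 + (1-u)\<^sup>2) + t\<^sup>2/2" .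
    qed
  qed
  also have "\<dots> = 3/2 * t\<^sup>2 * (2/3) + t\<^sup>2/2"
  proof (subst Bochner_Integration.integral_add)
    show "integrable unif (\<lambda>u. 3/2 * t\<^sup>2 * (u\<^sup>2 + (1-u)\<^sup>2))"
      using integrable_unif_squares by simp
    show "(\<integral>u. 3/2 * t\<^sup>2 * (u\<^sup>2 + (1-u)\<^sup>2) \<partial>unif) + (\<integral>u. t\<^sup>2/2 \<partial>unif) = 3/2 * t\<^sup>2 * (2/3) + t\<^sup>2/2"
      by (subst integral_mult_right_zero) (use unif.prob_space in \<open>simp add: expectation_unif_squares del: integral_mult_right_zero\<close>)
  qed simp
  finally show ?thesis by simp
qed

section \<open>Second moments and the behaviour of the characteristic function at 0\<close>

lemma (in real_distribution) char_taylor_1: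
  assumes "integrable M (\<lambda>x. x)" "integrable M (\<lambda>x. x\<^sup>2)"
  shows "cmod (char M t - 1 - \<i> * t * expectation (\<lambda>x. x)) \<le> t\<^sup>2 / 2 * expectation (\<lambda>x. x\<^sup>2)"
proof -
  have "cmod (char M t - (\<Sum>k \<le> 1. ((\<i> * t)^k / fact k) * expectation (\<lambda>x. x^k)))
    \<le> (\<bar>t\<bar>^1 / fact (Suc 1)) * expectation (\<lambda>x. min (2 * \<bar>x\<bar>^1 * Suc 1) (\<bar>t\<bar> * \<bar>x\<bar>^Suc 1))"
    using assms by (intro char_approx2) (auto simp: le_Suc_eq)
  also have "\<dots> \<le> (\<bar>t\<bar>^1 / fact (Suc 1)) * expectation (\<lambda>x. \<bar>t\<bar> * x\<^sup>2)"
  proof (intro mult_left_mono integral_mono)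
    have i: "integrable M (\<lambda>x. \<bar>t\<bar> * x\<^sup>2)" using assms by simp
    then show "integrable M (\<lambda>x. \<bar>t\<bar> * x\<^sup>2)" .
    show "integrable M (\<lambda>x. min (2 * \<bar>x\<bar>^1 * Suc 1) (\<bar>t\<bar> * \<bar>x\<bar>^Suc 1))"
      by (rule Bochner_Integration.integrable_bound[OF i]) (auto simp: power2_eq_square)
  qed (auto simp: power2_eq_square)
  also have "\<dots> = t\<^sup>2 / 2 * expectation (\<lambda>x. x\<^sup>2)"
    by (simp add: power2_eq_square)
  finally show ?thesis using prob_space by (simp add: diff_diff_eq)
qed

text \<open>The half-angle formula, arranged so that the right side contains a difference quotient
  of a sine at 0 with increment \<open>inverse r\<close>.\<close>

lemma one_minus_cos_scaled:
  fixes x r :: real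
  shows "2 * (1 - cos (x / r)) * r\<^sup>2 = (2 * (sin (inverse r * (x/2)) / inverse r))\<^sup>2"
proof -
  define s where "s = sin (inverse r * (x/2))"
  have "x / r = 2 * (inverse r * (x/2))" by (cases "r = 0") (simp_all add: field_simps)
  then have "cos (x / r) = 1 - 2 * s\<^sup>2"
    unfolding s_def using cos_double_sin by metis
  then have "2 * (1 - cos (x / r)) * r\<^sup>2 = (2 * (s * r))\<^sup>2"
    by (simp only: power_mult_distrib) simp
  also have "s * r = s / inverse r"
    by (simp only: divide_inverse inverse_inverse_eq)
  finally show ?thesis unfolding s_def .
qed

text \<open>Fatou's lemma applied to 2 (1 - cos (x / n)) n^2, which tends to x^2 and whose
  expectation the hypothesis bounds by 2 K. Once the second moment is finite, a nonzero mean would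
  contribute a term linear in t, which the quadratic bound excludes as t tends to 0.\<close>

lemma (in real_distribution) moments_from_char:
  assumes K: "\<And>t. cmod (char M t - 1) \<le> K * t\<^sup>2"
  shows "integrable M (\<lambda>x. x\<^sup>2)" "expectation (\<lambda>x. x\<^sup>2) \<le> 2 * K"
    "integrable M (\<lambda>x. x)" "expectation (\<lambda>x. x) = 0"
proof -
  have K0: "0 \<le> K" using order_trans[OF norm_ge_zero K[of 1]] by simp
  let ?h = "\<lambda>n x. 2 * (1 - cos (x / Suc n)) * (Suc n)\<^sup>2"
  have lim: "(\<lambda>n. ?h n x) \<longlonglongrightarrow> x\<^sup>2" for x :: real
  proof -
    have "((\<lambda>s. sin (s * (x/2))) has_real_derivative x/2) (at 0)"
      by (auto intro!: derivative_eq_intros)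
    then have "(\<lambda>h. sin (h * (x/2)) / h) \<midarrow>0\<rightarrow> x/2"
      by (simp add: DERIV_def)
    moreover have "filterlim (\<lambda>n. inverse (real (Suc n))) (at 0) sequentially"
      using LIMSEQ_inverse_real_of_nat by (simp add: filterlim_at del: of_nat_Suc)
    ultimately have "(\<lambda>n. sin (inverse (real (Suc n)) * (x/2)) / inverse (real (Suc n))) \<longlonglongrightarrow> x/2"
      by (rule filterlim_compose)
    then have "(\<lambda>n. (2 * (sin (inverse (real (Suc n)) * (x/2)) / inverse (real (Suc n))))\<^sup>2) \<longlonglongrightarrow> (2 * (x/2))\<^sup>2"
      by (rule tendsto_power[OF tendsto_mult_left])
    moreover have "(\<lambda>n. ?h n x) = (\<lambda>n. (2 * (sin (inverse (real (Suc n)) * (x/2)) / inverse (real (Suc n))))\<^sup>2)"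
      by (rule ext) (simp only: one_minus_cos_scaled of_nat_power)
    moreover have "(2 * (x/2))\<^sup>2 = x\<^sup>2" by simp
    ultimately show ?thesis by (simp only:)
  qed
  have hn: "0 \<le> ?h n x" for n x by simp
  have bnd: "(\<integral>\<^sup>+x. ennreal (?h n x) \<partial>M) \<le> ennreal (2 * K)" for n
  proof -
    have ic: "integrable M (\<lambda>x. cos (x / Suc n))"
      by (rule integrable_const_bound[where B = 1]) auto
    have "complex_integrable M (\<lambda>x. iexp (1 / Suc n * x))"
      by (rule integrable_const_bound[where B = 1]) (auto simp del: of_real_mult)
    then have "Re (char M (1 / Suc n)) = (\<integral>x. Re (iexp (1 / Suc n * x)) \<partial>M)"
      unfolding char_def by (rule integral_Re[symmetric])
    then have re: "(\<integral>x. cos (x / Suc n) \<partial>M) = Re (char M (1 / Suc n))"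
      by (simp add: Re_exp)
    have "integrable M (?h n)" using ic by (intro integrable_mult_left integrable_mult_right integrable_diff) auto
    then have nn: "(\<integral>\<^sup>+x. ennreal (?h n x) \<partial>M) = ennreal (\<integral>x. ?h n x \<partial>M)"
      by (rule nn_integral_eq_integral) (use hn in auto)
    have "(\<integral>x. 1 - cos (x / Suc n) \<partial>M) = 1 - (\<integral>x. cos (x / Suc n) \<partial>M)"
      using ic prob_space by (subst Bochner_Integration.integral_diff) auto
    then have e: "(\<integral>x. ?h n x \<partial>M) = 2 * (1 - Re (char M (1 / Suc n))) * (Suc n)\<^sup>2"
      unfolding re[symmetric] by (simp only: integral_mult_left_zero integral_mult_right_zero)
    have "1 - Re (char M (1 / Suc n)) = Re (1 - char M (1 / Suc n))" by simp
    also have "\<dots> \<le> cmod (1 - char M (1 / Suc n))" by (rule complex_Re_le_cmod)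
    also have "\<dots> = cmod (char M (1 / Suc n) - 1)" by (rule norm_minus_commute)
    also have "\<dots> \<le> K * (1 / Suc n)\<^sup>2" by (rule K)
    finally have "2 * (1 - Re (char M (1 / Suc n))) * (Suc n)\<^sup>2 \<le> 2 * (K * (1 / Suc n)\<^sup>2) * (Suc n)\<^sup>2"
      by (intro mult_right_mono) auto
    also have "\<dots> = 2 * K" by (simp add: power_divide del: of_nat_Suc)
    finally show ?thesis unfolding nn e by (rule ennreal_leI)
  qed
  have "(\<integral>\<^sup>+x. ennreal (x\<^sup>2) \<partial>M) = (\<integral>\<^sup>+x. liminf (\<lambda>n. ennreal (?h n x)) \<partial>M)"
    by (rule nn_integral_cong, rule lim_imp_Liminf[OF trivial_limit_sequentially tendsto_ennrealI[OF lim], symmetric])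
  also have "\<dots> \<le> liminf (\<lambda>n. \<integral>\<^sup>+x. ennreal (?h n x) \<partial>M)"
    by (rule nn_integral_liminf) auto
  also have "\<dots> \<le> ennreal (2 * K)"
    by (rule Liminf_le[OF sequentially_bot always_eventually[OF allI[OF bnd]]])
  finally have nn: "(\<integral>\<^sup>+x. ennreal (x\<^sup>2) \<partial>M) \<le> ennreal (2 * K)" .
  then show i2: "integrable M (\<lambda>x. x\<^sup>2)"
    by (intro integrableI_nonneg) (auto intro: le_less_trans)
  show "expectation (\<lambda>x. x\<^sup>2) \<le> 2 * K"
    using nn K0 nn_integral_eq_integral[OF i2] by (simp add: ennreal_le_iff)
  show i1: "integrable M (\<lambda>x. x)"
    by (rule square_integrable_imp_integrable[OF _ i2]) auto
  have *: "\<bar>expectation (\<lambda>x. x)\<bar> \<le> (K + expectation (\<lambda>x. x\<^sup>2) / 2) * inverse (real (Suc n))" for n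
  proof -
    define t where "t = inverse (real (Suc n))"
    have t: "t > 0" by (simp add: t_def)
    have "cmod (\<i> * t * expectation (\<lambda>x. x))
        = cmod ((char M t - 1) - (char M t - 1 - \<i> * t * expectation (\<lambda>x. x)))" by simp
    also have "\<dots> \<le> cmod (char M t - 1) + cmod (char M t - 1 - \<i> * t * expectation (\<lambda>x. x))"
      by (rule norm_triangle_ineq4)
    also have "\<dots> \<le> K * t\<^sup>2 + t\<^sup>2 / 2 * expectation (\<lambda>x. x\<^sup>2)"
      by (intro add_mono K char_taylor_1 i1 i2)
    also have "\<dots> = t * ((K + expectation (\<lambda>x. x\<^sup>2) / 2) * t)"
      by (simp add: power2_eq_square algebra_simps)
    finally have "t * \<bar>expectation (\<lambda>x. x)\<bar> \<le> t * ((K + expectation (\<lambda>x. x\<^sup>2) / 2) * t)"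
      using t by (simp add: norm_mult)
    with t show ?thesis unfolding t_def[symmetric] by simp
  qed
  have "(\<lambda>n. (K + expectation (\<lambda>x. x\<^sup>2) / 2) * inverse (real (Suc n))) \<longlonglongrightarrow> (K + expectation (\<lambda>x. x\<^sup>2) / 2) * 0"
    by (intro tendsto_intros LIMSEQ_inverse_real_of_nat)
  then have "\<bar>expectation (\<lambda>x. x)\<bar> \<le> 0"
    using * by (intro LIMSEQ_le_const) auto
  then show "expectation (\<lambda>x. x) = 0" by simp
qed

section \<open>Uniqueness and existence of the Quicksort law\<close>

lemma contraction_imp_zero:
  fixes a C :: real
  assumes "\<And>n. a \<le> (2/3)^n * C"
  shows "a \<le> 0"
proof -
  have "(\<lambda>n. (2/3::real)^n * C) \<longlonglongrightarrow> 0 * C"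
    by (intro tendsto_intros LIMSEQ_realpow_zero) auto
  then show ?thesis using assms by (intro LIMSEQ_le_const) auto
qed

lemma is_qs_law_unique:
  assumes "is_qs_law M" "is_qs_law N"
  shows "M = N"
proof -
  interpret M: real_distribution M
    using assms(1) by (auto simp: is_qs_law_def real_distribution_def real_distribution_axioms_def)
  interpret N: real_distribution N
    using assms(2) by (auto simp: is_qs_law_def real_distribution_def real_distribution_axioms_def)
  have rd: "real_distribution M" "real_distribution N" by unfold_locales
  have fix_eq: "qs_map M = M" "qs_map N = N" using assms by (auto simp: is_qs_law_def)
  \<comment> \<open>With both means zero, the Taylor estimate gives the distance bound with this
    constant; each use of the fixed-point equations then gains a factor 2/3.\<close>
  define C where "C = (M.expectation (\<lambda>x. x\<^sup>2) + N.expectation (\<lambda>x. x\<^sup>2)) / 2"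
  have "cmod (char M t - char N t) \<le> (2/3)^n * C * t\<^sup>2" for n t
  proof (induction n arbitrary: t)
    case 0
    have "cmod (char M t - 1) \<le> t\<^sup>2 / 2 * M.expectation (\<lambda>x. x\<^sup>2)"
      "cmod (char N t - 1) \<le> t\<^sup>2 / 2 * N.expectation (\<lambda>x. x\<^sup>2)"
      using M.char_taylor_1[of t] N.char_taylor_1[of t] assms by (auto simp: is_qs_law_def)
    then show ?case
      using norm_triangle_ineq4[of "char M t - 1" "char N t - 1"]
      by (simp add: C_def algebra_simps add_divide_distrib)
  next
    case (Suc n)
    from char_qs_map_diff[OF rd this, of t] show ?case by (simp add: fix_eq mult_ac)
  qed
  then have "cmod (char M t - char N t) \<le> 0" for t
    by (intro contraction_imp_zero[where C = "C * t\<^sup>2"]) (simp add: mult_ac)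
  then have "char M = char N" by (intro ext) simp
  with rd show ?thesis by (rule Levy_uniqueness)
qed

lemma tight_second_moment:
  assumes rd: "\<And>n. real_distribution (M n)"
    and i: "\<And>n. integrable (M n) (\<lambda>x. x\<^sup>2)" and C: "\<And>n. (\<integral>x. x\<^sup>2 \<partial>M n) \<le> C"
  shows "tight M"
  unfolding tight_def
proof (intro conjI allI impI rd)
  fix e :: real assume e: "e > 0"
  have "0 \<le> (\<integral>x. x\<^sup>2 \<partial>M 0)" by simp
  with C[of 0] have C0: "0 \<le> C" by linarith
  \<comment> \<open>Chebyshev's inequality bounds the tail by C / a^2. Since a is at least 1 and
    exceeds C / e, this is at most C / a < e.\<close>
  define a where "a = 1 + C / e"
  have a: "a \<ge> 1" "a > C / e" using C0 e by (auto simp: a_def)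
  have "measure (M n) {-a<..a} > 1 - e" for n
  proof -
    interpret real_distribution "M n" by (rule rd)
    have "measure (M n) {x \<in> space (M n). a\<^sup>2 \<le> x\<^sup>2} \<le> (\<integral>x. x\<^sup>2 \<partial>M n) / a\<^sup>2"
      using a by (intro integral_Markov_inequality_measure[where A = "{}"] i) auto
    also have "\<dots> \<le> C / a\<^sup>2" using C by (intro divide_right_mono) auto
    also have "\<dots> < e"
    proof -
      have "C < e * a" using a e by (simp add: field_simps)
      also have "\<dots> \<le> e * a\<^sup>2" using a e by (simp add: power2_eq_square)
      finally show ?thesis using a by (simp add: divide_less_eq)
    qed
    finally have "prob {x. a\<^sup>2 \<le> x\<^sup>2} < e" by simp
    moreover have "prob (UNIV - {-a<..a}) \<le> prob {x. a\<^sup>2 \<le> x\<^sup>2}"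
    proof (rule finite_measure_mono)
      show "UNIV - {-a<..a} \<subseteq> {x. a\<^sup>2 \<le> x\<^sup>2}"
        using a by (auto simp: abs_le_square_iff[symmetric] abs_le_iff not_less not_le)
    qed auto
    moreover have "prob (UNIV - {-a<..a}) = 1 - prob {-a<..a}"
      using prob_compl[of "{-a<..a}"] by simp
    ultimately show ?thesis by linarith
  qed
  then show "\<exists>a b. a < b \<and> (\<forall>n. measure (M n) {a<..b} > 1 - e)"
    using a by (intro exI[of _ "-a"] exI[of _ a]) auto
qed

lemma tendsto_char_qs_map:
  assumes rd: "\<And>n. real_distribution (M n)" and N: "real_distribution N"
    and lim: "\<And>t. (\<lambda>n. char (M n) t) \<longlonglongrightarrow> char N t"
  shows "(\<lambda>n. char (qs_map (M n)) t) \<longlonglongrightarrow> char (qs_map N) t"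
  unfolding char_qs_map(1)[OF rd] char_qs_map(1)[OF N]
proof (rule integral_dominated_convergence[where w = "\<lambda>_. 1"])
  have [measurable]: "char N \<in> borel_measurable borel" "char (M n) \<in> borel_measurable borel" for n
    by (rule real_distribution.char_measurable[OF rd] real_distribution.char_measurable[OF N])+
  have le1: "cmod (char (M n) s) \<le> 1" for n s
    by (rule real_distribution.cmod_char_le_1[OF rd])
  show "(\<lambda>u. char N (u*t) * char N ((1-u)*t) * iexp (t * qs_g u)) \<in> borel_measurable unif"
    by measurable
  show "(\<lambda>u. char (M n) (u*t) * char (M n) ((1-u)*t) * iexp (t * qs_g u)) \<in> borel_measurable unif" for n
    by measurable
  show "AE u in unif. (\<lambda>n. char (M n) (u*t) * char (M n) ((1-u)*t) * iexp (t * qs_g u))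
      \<longlonglongrightarrow> char N (u*t) * char N ((1-u)*t) * iexp (t * qs_g u)"
    by (rule AE_I2) (rule tendsto_mult[OF tendsto_mult[OF lim lim] tendsto_const])
  show "AE u in unif. norm (char (M n) (u*t) * char (M n) ((1-u)*t) * iexp (t * qs_g u)) \<le> 1" for n
    by (rule AE_I2) (simp add: norm_mult mult_le_one le1 del: of_real_mult)
qed simp

text \<open>Iterate from the Dirac mass at 0. The bound \<open>c1\<close> is invariant, so second
  moments stay bounded and a subsequence converges weakly. By \<open>c2\<close> consecutive iterates
  approach each other, so the subsequence and its image under the map have the same limit, which is
  therefore a fixed point. The limit inherits \<open>c1\<close>, hence mean 0 and finite
  variance.\<close>

lemma is_qs_law_exists: "\<exists>M. is_qs_law M"
proof -
  define M where "M n = (qs_map ^^ n) (return borel 0)" for n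
  have M0: "M 0 = return borel 0" and MS: "M (Suc n) = qs_map (M n)" for n
    by (simp_all add: M_def)
  have rd: "real_distribution (M n)" for n
  proof (induction n)
    case 0
    show ?case by (simp add: M0 real_distribution_def real_distribution_axioms_def prob_space_return)
  qed (simp add: MS real_distribution_qs_map)
  have c1: "cmod (char (M n) t - 1) \<le> 3/2 * t\<^sup>2" for n t
  proof (induction n arbitrary: t)
    case 0
    show ?case by (simp add: M0 char_def integral_return)
  next
    case (Suc n)
    show ?case unfolding MS by (rule char_qs_map_minus_1[OF rd Suc])
  qed
  have c2: "cmod (char (M (Suc n)) t - char (M n) t) \<le> (2/3)^n * (3/2) * t\<^sup>2" for n t
  proof (induction n arbitrary: t)
    case 0
    show ?case using c1[of 1 t] by (simp add: M0 char_def integral_return)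
  next
    case (Suc n)
    from char_qs_map_diff[OF rd rd this, of t] show ?case by (simp add: MS mult_ac)
  qed
  have "tight M"
  proof (rule tight_second_moment[OF rd])
    fix n
    interpret real_distribution "M n" by (rule rd)
    show "integrable (M n) (\<lambda>x. x\<^sup>2)" "(\<integral>x. x\<^sup>2 \<partial>M n) \<le> 2 * (3/2)"
      by (rule moments_from_char[OF c1])+
  qed
  from tight_imp_convergent_subsubsequence[OF this strict_mono_id, unfolded comp_id]
  obtain r N where r: "strict_mono r" and N: "real_distribution N" and conv: "weak_conv_m (M \<circ> r) N"
    by blast
  interpret N: real_distribution N by fact
  have lim: "(\<lambda>n. char (M (r n)) t) \<longlonglongrightarrow> char N t" for t
    using levy_continuity1[OF _ N conv, of t] rd by simp
  have "(\<lambda>n. cmod (char (M (r n)) t - 1)) \<longlonglongrightarrow> cmod (char N t - 1)" for t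
    by (intro tendsto_intros lim)
  then have cN: "cmod (char N t - 1) \<le> 3/2 * t\<^sup>2" for t
    by (rule LIMSEQ_le_const2) (use c1 in auto)
  have "char (qs_map N) t = char N t" for t
  proof (rule LIMSEQ_unique)
    show "(\<lambda>n. char (M (Suc (r n))) t) \<longlonglongrightarrow> char (qs_map N) t"
      unfolding MS by (rule tendsto_char_qs_map[OF rd N lim])
    have "(\<lambda>n. char (M (Suc (r n))) t - char (M (r n)) t) \<longlonglongrightarrow> 0"
    proof (rule Lim_null_comparison)
      show "\<forall>\<^sub>F n in sequentially. norm (char (M (Suc (r n))) t - char (M (r n)) t) \<le> (2/3)^(r n) * (3/2) * t\<^sup>2"
        using c2 by simp
      have "(\<lambda>n. (2/3::real)^n * (3/2) * t\<^sup>2) \<longlonglongrightarrow> 0 * (3/2) * t\<^sup>2"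
        by (intro tendsto_intros LIMSEQ_realpow_zero) auto
      from LIMSEQ_subseq_LIMSEQ[OF this r] show "(\<lambda>n. (2/3)^(r n) * (3/2) * t\<^sup>2) \<longlonglongrightarrow> 0"
        by (simp add: o_def)
    qed
    from tendsto_add[OF this lim[of t]] show "(\<lambda>n. char (M (Suc (r n))) t) \<longlonglongrightarrow> char N t" by simp
  qed
  then have "char (qs_map N) = char N" by (rule ext)
  with real_distribution_qs_map[OF N] N have "qs_map N = N"
    by (rule Levy_uniqueness)
  then have "is_qs_law N"
    using N.moments_from_char[OF cN] N.prob_space_axioms by (simp add: is_qs_law_def)
  then show ?thesis ..
qed

lemma is_qs_law_quicksort_law: "is_qs_law quicksort_law"
  unfolding quicksort_law_def
  by (rule theI') (use is_qs_law_exists is_qs_law_unique in blast)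

section \<open>A van der Corput estimate\<close>

lemma has_vector_derivative_iexp_compose:
  assumes "(\<phi> has_real_derivative d) (at x within S)"
  shows "((\<lambda>x. iexp (\<phi> x)) has_vector_derivative d *\<^sub>R (\<i> * iexp (\<phi> x))) (at x within S)"
  using vector_diff_chain_within[OF assms[unfolded has_real_derivative_iff_has_vector_derivative]
      has_vector_derivative_iexp[of "\<phi> x" "\<phi> ` S"]]
  by (simp add: o_def)

text \<open>
  Multiply the integrand by \<open>\<phi>' / W\<close> as long as \<open>\<phi>' \<le> W\<close>, that is, integrate by parts with
  the multiplier \<open>min (1 / \<phi>') (1 / W)\<close>: the remainder \<open>1 - \<phi>' / W\<close> is integrated against
  \<open>du \<le> d\<phi>' / l\<close>, which yields a better constant than the trivial bound on that interval.
\<close>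

lemma van_der_Corput_one_sided:
  fixes \<phi> \<phi>' \<phi>'' :: "real \<Rightarrow> real"
  assumes ab: "a \<le> b" "b \<le> c"
    and d1: "\<And>x. x \<in> {a..c} \<Longrightarrow> (\<phi> has_real_derivative \<phi>' x) (at x)"
    and d2: "\<And>x. x \<in> {a..c} \<Longrightarrow> (\<phi>' has_real_derivative \<phi>'' x) (at x)"
    and lam: "0 < l" "\<And>x. x \<in> {a..c} \<Longrightarrow> l \<le> \<phi>'' x"
    and cont: "continuous_on {a..c} \<phi>''"
    and W: "\<phi>' a = 0" "\<phi>' b = W" "0 < W"
  shows "cmod (integral {a..c} (\<lambda>x. iexp (\<phi> x))) \<le> 2 / W + W / (2 * l)"
proof -
  have mono: "\<phi>' x \<le> \<phi>' y" if "a \<le> x" "x \<le> y" "y \<le> c" for x y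
  proof (rule DERIV_nonneg_imp_nondecreasing[OF that(2)])
    fix z assume "x \<le> z" "z \<le> y"
    then have "z \<in> {a..c}" using that by auto
    with d2[of z] lam show "\<exists>y. (\<phi>' has_real_derivative y) (at z) \<and> 0 \<le> y" by fastforce
  qed
  have c0: "continuous_on {a..c} \<phi>" and c1: "continuous_on {a..c} \<phi>'"
    by (rule continuous_at_imp_continuous_on, use d1 d2 in \<open>blast intro: DERIV_isCont\<close>)+
  have ce: "continuous_on {a..c} (\<lambda>x. iexp (\<phi> x))"
    by (intro continuous_intros c0)
  have int: "(\<lambda>x. iexp (\<phi> x)) integrable_on {a..c}"
    by (rule integrable_continuous_interval[OF ce])
  have split: "integral {a..c} (\<lambda>x. iexp (\<phi> x)) =
      integral {a..b} (\<lambda>x. iexp (\<phi> x)) + integral {b..c} (\<lambda>x. iexp (\<phi> x))"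
    by (rule Henstock_Kurzweil_Integration.integral_combine[OF ab int, symmetric])
  let ?E = "\<lambda>x. iexp (\<phi> x)"
  let ?r1 = "\<lambda>x. complex_of_real (1 - \<phi>' x / W) * ?E x"
  \<comment> \<open>Near the stationary point the integrand is split as \<open>\<phi>' / W\<close>
    times itself plus \<open>?r1\<close>; the first part has the exact antiderivative -i E /
    W.\<close>
  have "((\<lambda>x. \<phi>' x *\<^sub>R (\<i> * ?E x)) has_integral (?E b - ?E a)) {a..b}"
    by (rule fundamental_theorem_of_calculus[OF ab(1)])
      (rule has_vector_derivative_iexp_compose[OF has_field_derivative_at_within[OF d1]], use ab in auto)
  then have "((\<lambda>x. (\<phi>' x *\<^sub>R (\<i> * ?E x)) * (- \<i> / W)) has_integral (?E b - ?E a) * (- \<i> / W)) {a..b}"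
    by (rule has_integral_mult_left)
  also have "(\<lambda>x. (\<phi>' x *\<^sub>R (\<i> * ?E x)) * (- \<i> / W)) = (\<lambda>x. ?E x - ?r1 x)"
    using W(3) by (auto simp: scaleR_conv_of_real field_simps)
  finally have h1: "((\<lambda>x. ?E x - ?r1 x) has_integral (?E b - ?E a) * (- \<i> / W)) {a..b}" .
  have r1: "?r1 integrable_on {a..b}"
    by (rule integrable_continuous_interval)
      (use W(3) ab in \<open>auto intro!: continuous_intros continuous_on_subset[OF c0] continuous_on_subset[OF c1]\<close>)
  have e1: "integral {a..b} ?E = (?E b - ?E a) * (- \<i> / W) + integral {a..b} ?r1"
    using has_integral_add[OF h1 integrable_integral[OF r1]] by (simp add: integral_unique)
  \<comment> \<open>Since \<open>\<phi>'' / l\<close> is at least 1, inserting it as a factor makes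
    the majorant of \<open>?r1\<close> an exact derivative, and the constant W / (2 l) is its total
    increase.\<close>
  have n1: "cmod (integral {a..b} ?r1) \<le> W / (2 * l)"
  proof -
    let ?G = "\<lambda>x. (\<phi>' x - (\<phi>' x)\<^sup>2 / (2 * W)) / l"
    let ?g = "\<lambda>x. (1 - \<phi>' x / W) * \<phi>'' x / l"
    have "(?g has_integral ?G b - ?G a) {a..b}"
    proof (rule fundamental_theorem_of_calculus[OF ab(1)])
      fix x assume "x \<in> {a..b}"
      then have "(\<phi>' has_real_derivative \<phi>'' x) (at x within {a..b})"
        using ab by (intro has_field_derivative_at_within[OF d2]) auto
      then show "(?G has_vector_derivative ?g x) (at x within {a..b})"
        unfolding has_real_derivative_iff_has_vector_derivative[symmetric]
        using W(3) lam(1) by (auto intro!: derivative_eq_intros simp: field_simps)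
    qed
    also have "?G b - ?G a = W / (2 * l)"
      using W lam(1) by (simp add: field_simps power2_eq_square)
    finally have G: "(?g has_integral W / (2 * l)) {a..b}" .
    have "cmod (integral {a..b} ?r1) \<le> integral {a..b} ?g"
    proof (rule integral_norm_bound_integral[OF r1])
      show "?g integrable_on {a..b}" using G by blast
      fix x assume x: "x \<in> {a..b}"
      then have "0 \<le> 1 - \<phi>' x / W" "1 \<le> \<phi>'' x / l"
        using mono[of x b] W lam ab by auto
      then have "(1 - \<phi>' x / W) * 1 \<le> (1 - \<phi>' x / W) * (\<phi>'' x / l)"
        by (intro mult_left_mono)
      with \<open>0 \<le> 1 - \<phi>' x / W\<close> show "cmod (?r1 x) \<le> ?g x"
        by (simp add: norm_mult del: of_real_diff of_real_divide)
    qed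
    then show ?thesis unfolding integral_unique[OF G] .
  qed
  have pos: "W \<le> \<phi>' x" if "x \<in> {b..c}" for x
    using mono[of b x] W that ab by auto
  \<comment> \<open>Away from the stationary point: -i E / \<phi>' has derivative E minus
    \<open>?r2\<close>.\<close>
  let ?r2 = "\<lambda>x. complex_of_real (\<phi>'' x / (\<phi>' x)\<^sup>2) * ?E x * (- \<i>)"
  have h2: "((\<lambda>x. ?E x - ?r2 x) has_integral
      (inverse (\<phi>' c) *\<^sub>R (?E c * (- \<i>)) - inverse (\<phi>' b) *\<^sub>R (?E b * (- \<i>)))) {b..c}"
  proof (rule fundamental_theorem_of_calculus[OF ab(2)])
    fix x assume x: "x \<in> {b..c}"
    then have "x \<in> {a..c}" using ab by auto
    note d1[OF this] d2[OF this]
    note dx = this[THEN has_field_derivative_at_within, of "{b..c}"]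
    have p: "\<phi>' x \<noteq> 0" using pos[OF x] W(3) by auto
    have "((\<lambda>x. inverse (\<phi>' x)) has_real_derivative - (\<phi>'' x / (\<phi>' x)\<^sup>2)) (at x within {b..c})"
      using DERIV_inverse'[OF dx(2) p] p by (simp add: field_simps power2_eq_square)
    moreover have "((\<lambda>x. ?E x * (- \<i>)) has_vector_derivative (\<phi>' x *\<^sub>R (\<i> * ?E x)) * (- \<i>)) (at x within {b..c})"
      by (rule has_vector_derivative_mult_left[OF has_vector_derivative_iexp_compose[OF dx(1)]])
    ultimately have "((\<lambda>x. inverse (\<phi>' x) *\<^sub>R (?E x * (- \<i>))) has_vector_derivative
        inverse (\<phi>' x) *\<^sub>R ((\<phi>' x *\<^sub>R (\<i> * ?E x)) * (- \<i>)) + (- (\<phi>'' x / (\<phi>' x)\<^sup>2)) *\<^sub>R (?E x * (- \<i>))) (at x within {b..c})"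
      by (rule has_vector_derivative_scaleR)
    also have "inverse (\<phi>' x) *\<^sub>R ((\<phi>' x *\<^sub>R (\<i> * ?E x)) * (- \<i>)) + (- (\<phi>'' x / (\<phi>' x)\<^sup>2)) *\<^sub>R (?E x * (- \<i>)) = ?E x - ?r2 x"
      using p by (simp add: scaleR_conv_of_real field_simps)
    finally show "((\<lambda>x. inverse (\<phi>' x) *\<^sub>R (?E x * (- \<i>))) has_vector_derivative ?E x - ?r2 x) (at x within {b..c})" .
  qed
  have sub: "{b..c} \<subseteq> {a..c}" using ab by auto
  have r2: "?r2 integrable_on {b..c}"
    by (rule integrable_continuous_interval)
      (use W(3) pos in \<open>force intro!: continuous_intros continuous_on_subset[OF c0 sub]
        continuous_on_subset[OF c1 sub] continuous_on_subset[OF cont sub]\<close>)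
  have e2: "integral {b..c} ?E = inverse (\<phi>' c) *\<^sub>R (?E c * (- \<i>)) - inverse W *\<^sub>R (?E b * (- \<i>)) + integral {b..c} ?r2"
    using has_integral_add[OF h2 integrable_integral[OF r2]] W by (simp add: integral_unique)
  \<comment> \<open>The modulus of \<open>?r2\<close> is the derivative of -1 / \<phi>'. Its
    integral contains the negative of the boundary term at c, so c disappears from the final
    bound.\<close>
  have n2: "cmod (integral {b..c} ?r2) \<le> 1 / W - inverse (\<phi>' c)"
  proof -
    let ?g = "\<lambda>x. \<phi>'' x / (\<phi>' x)\<^sup>2"
    have "(?g has_integral (- inverse (\<phi>' c)) - (- inverse (\<phi>' b))) {b..c}"
    proof (rule fundamental_theorem_of_calculus[OF ab(2)])
      fix x assume x: "x \<in> {b..c}"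
      then have "(\<phi>' has_real_derivative \<phi>'' x) (at x within {b..c})"
        using ab by (intro has_field_derivative_at_within[OF d2]) auto
      moreover have "\<phi>' x \<noteq> 0" using pos[OF x] W(3) by auto
      ultimately show "((\<lambda>x. - inverse (\<phi>' x)) has_vector_derivative ?g x) (at x within {b..c})"
        unfolding has_real_derivative_iff_has_vector_derivative[symmetric]
        by (auto intro!: derivative_eq_intros simp: field_simps power2_eq_square)
    qed
    then have G: "(?g has_integral 1 / W - inverse (\<phi>' c)) {b..c}" using W by (simp add: inverse_eq_divide)
    have "cmod (integral {b..c} ?r2) \<le> integral {b..c} ?g"
    proof (rule integral_norm_bound_integral[OF r2])
      show "?g integrable_on {b..c}" using G by blast
      fix x assume "x \<in> {b..c}"
      then have "0 \<le> \<phi>'' x" using lam(1) lam(2)[of x] ab by auto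
      then show "cmod (?r2 x) \<le> ?g x"
        by (simp add: norm_mult norm_divide norm_power)
    qed
    then show ?thesis unfolding integral_unique[OF G] .
  qed
  have pc: "0 < \<phi>' c" using pos[of c] ab W(3) by auto
  \<comment> \<open>Both multipliers equal 1 / W at b, so the boundary terms there cancel.\<close>
  have eq: "integral {a..c} ?E = - (?E a * (- \<i> / W)) + integral {a..b} ?r1
      + inverse (\<phi>' c) *\<^sub>R (?E c * (- \<i>)) + integral {b..c} ?r2"
    unfolding split e1 e2 using W(3) by (simp add: scaleR_conv_of_real field_simps)
  have "cmod (integral {a..c} ?E) \<le> cmod (- (?E a * (- \<i> / W))) + cmod (integral {a..b} ?r1)
      + cmod (inverse (\<phi>' c) *\<^sub>R (?E c * (- \<i>))) + cmod (integral {b..c} ?r2)"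
    unfolding eq by (intro norm_triangle_le add_mono order_refl)
  also have "\<dots> \<le> 1 / W + W / (2 * l) + inverse (\<phi>' c) + (1 / W - inverse (\<phi>' c))"
    using n1 n2 pc W(3) by (intro add_mono) (auto simp: norm_mult norm_divide)
  finally show ?thesis by simp
qed

text \<open>Under x to -x the first derivative of the phase changes sign and the second does not,
  which moves the stationary point from the right end to the left end.\<close>

lemma van_der_Corput_reflected:
  fixes \<phi> \<phi>' \<phi>'' :: "real \<Rightarrow> real"
  assumes ab: "a \<le> b" "b \<le> c"
    and d1: "\<And>x. x \<in> {a..c} \<Longrightarrow> (\<phi> has_real_derivative \<phi>' x) (at x)"
    and d2: "\<And>x. x \<in> {a..c} \<Longrightarrow> (\<phi>' has_real_derivative \<phi>'' x) (at x)"
    and lam: "0 < l" "\<And>x. x \<in> {a..c} \<Longrightarrow> l \<le> \<phi>'' x"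
    and cont: "continuous_on {a..c} \<phi>''"
    and W: "\<phi>' c = 0" "\<phi>' b = - W" "0 < W"
  shows "cmod (integral {a..c} (\<lambda>x. iexp (\<phi> x))) \<le> 2 / W + W / (2 * l)"
proof -
  have "integral {a..c} (\<lambda>x. iexp (\<phi> x)) = integral {-c..-a} (\<lambda>x. iexp (\<phi> (- x)))"
    by (rule Henstock_Kurzweil_Integration.integral_reflect_real[symmetric])
  moreover have "cmod (integral {-c..-a} (\<lambda>x. iexp (\<phi> (- x)))) \<le> 2 / W + W / (2 * l)"
  proof (rule van_der_Corput_one_sided)
    show "- c \<le> - b" "- b \<le> - a" using ab by auto
    fix x assume "x \<in> {-c..-a}"
    then have x: "- x \<in> {a..c}" by auto
    have m: "((\<lambda>x. - x) has_real_derivative - 1) (at x)" by (auto intro!: derivative_eq_intros)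
    show "((\<lambda>x. \<phi> (- x)) has_real_derivative - \<phi>' (- x)) (at x)"
      using DERIV_chain2[OF d1[OF x] m] by simp
    show "((\<lambda>x. - \<phi>' (- x)) has_real_derivative \<phi>'' (- x)) (at x)"
      using DERIV_minus[OF DERIV_chain2[OF d2[OF x] m]] by simp
    show "l \<le> \<phi>'' (- x)" by (rule lam(2)[OF x])
  next
    show "continuous_on {-c..-a} (\<lambda>x. \<phi>'' (- x))"
      by (rule continuous_on_compose2[OF cont]) (auto intro!: continuous_intros)
  qed (use W lam(1) in auto)
  ultimately show ?thesis by simp
qed

text \<open>The phase is split at its stationary point c. The threshold W = 2 sqrt l minimises 2 / W
  + W / (2 l), with minimum 2 / sqrt l on each side.\<close>

lemma van_der_Corput_two_sided:
  fixes \<phi> \<phi>' \<phi>'' :: "real \<Rightarrow> real"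
  assumes le: "p \<le> b\<^sub>1" "b\<^sub>1 \<le> c" "c \<le> b\<^sub>2" "b\<^sub>2 \<le> q"
    and d1: "\<And>x. x \<in> {p..q} \<Longrightarrow> (\<phi> has_real_derivative \<phi>' x) (at x)"
    and d2: "\<And>x. x \<in> {p..q} \<Longrightarrow> (\<phi>' has_real_derivative \<phi>'' x) (at x)"
    and lam: "0 < l" "\<And>x. x \<in> {p..q} \<Longrightarrow> l \<le> \<phi>'' x"
    and cont: "continuous_on {p..q} \<phi>''"
    and W: "\<phi>' b\<^sub>1 = - (2 * sqrt l)" "\<phi>' c = 0" "\<phi>' b\<^sub>2 = 2 * sqrt l"
  shows "cmod (integral {p..q} (\<lambda>x. iexp (\<phi> x))) \<le> 4 / sqrt l"
proof -
  have s: "0 < sqrt l" using lam(1) by simp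
  have half: "2 / (2 * sqrt l) + 2 * sqrt l / (2 * l) = 2 / sqrt l"
    using lam(1) real_div_sqrt[of l] by (simp add: field_simps)
  have "continuous_on {p..q} \<phi>"
    by (rule continuous_at_imp_continuous_on) (use d1 in \<open>blast intro: DERIV_isCont\<close>)
  then have int: "(\<lambda>x. iexp (\<phi> x)) integrable_on {p..q}"
    by (intro integrable_continuous_interval continuous_intros)
  have "cmod (integral {p..c} (\<lambda>x. iexp (\<phi> x))) \<le> 2 / sqrt l"
    unfolding half[symmetric]
    by (rule van_der_Corput_reflected[where b = b\<^sub>1 and \<phi>' = \<phi>' and \<phi>'' = \<phi>''])
      (use assms s in \<open>auto intro: continuous_on_subset\<close>)
  moreover have "cmod (integral {c..q} (\<lambda>x. iexp (\<phi> x))) \<le> 2 / sqrt l"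
    unfolding half[symmetric]
    by (rule van_der_Corput_one_sided[where b = b\<^sub>2 and \<phi>' = \<phi>' and \<phi>'' = \<phi>''])
      (use assms s in \<open>auto intro: continuous_on_subset\<close>)
  moreover have "integral {p..q} (\<lambda>x. iexp (\<phi> x)) =
      integral {p..c} (\<lambda>x. iexp (\<phi> x)) + integral {c..q} (\<lambda>x. iexp (\<phi> x))"
    by (rule Henstock_Kurzweil_Integration.integral_combine[OF _ _ int, symmetric]) (use le in auto)
  ultimately show ?thesis
    using norm_triangle_ineq[of "integral {p..c} (\<lambda>x. iexp (\<phi> x))" "integral {c..q} (\<lambda>x. iexp (\<phi> x))"]
    by simp
qed

section \<open>The oscillatory integral with the Quicksort phase\<close>

lemma cmod_integral_unimodular_le:
  fixes h :: "real \<Rightarrow> complex"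
  assumes "h integrable_on {a..b}" "a \<le> b" "\<And>x. cmod (h x) = 1"
  shows "cmod (integral {a..b} h) \<le> b - a"
  using integral_norm_bound_integral[OF assms(1) integrable_const_ivl, of 1] assms(2,3) by simp

lemma DERIV_qs_g:
  assumes "0 < u" "u < 1"
  shows "(qs_g has_real_derivative 2 * ln u - 2 * ln (1 - u)) (at u)"
proof -
  have d: "((\<lambda>v::real. 2 * v * ln v) has_real_derivative 2 * ln v + 2) (at v)" if "0 < v" for v
    using that by (auto intro!: derivative_eq_intros)
  have m: "((\<lambda>u::real. 1 - u) has_real_derivative - 1) (at u)"
    by (auto intro!: derivative_eq_intros)
  show ?thesis
    unfolding qs_g_def[abs_def]
    using DERIV_add[OF DERIV_add[OF d[OF assms(1)] DERIV_chain2[OF d m]] DERIV_const[of 1]] assms(2) by simp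
qed

text \<open>The second derivative of the phase is 2 t / (u (1 - u)), at least 8 t, so the two-sided
  estimate with l = 8 t gives 4 / sqrt (8 t), whatever the slope \<open>a\<close>. The phase is
  singular at 0 and 1; short end intervals of total length at most e are estimated trivially, and e
  is arbitrary.\<close>

lemma norm_integral_qs_phase:
  assumes t: "0 < t"
  shows "cmod (integral {0..1} (\<lambda>u. iexp (t * (a * u + qs_g u)))) \<le> sqrt 2 / sqrt t"
proof -
  define \<phi> where "\<phi> u = t * (a * u + qs_g u)" for u
  define \<phi>' where "\<phi>' u = t * (a + 2 * ln u - 2 * ln (1 - u))" for u
  define \<phi>'' where "\<phi>'' u = t * (2 / u + 2 / (1 - u))" for u :: real
  have d1: "(\<phi> has_real_derivative \<phi>' x) (at x)" if "0 < x" "x < 1" for x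
    unfolding \<phi>_def \<phi>'_def
    by (rule derivative_eq_intros DERIV_qs_g refl that)+ simp
  have d2: "(\<phi>' has_real_derivative \<phi>'' x) (at x)" if "0 < x" "x < 1" for x
    unfolding \<phi>'_def \<phi>''_def using that
    by (auto intro!: derivative_eq_intros simp: field_simps)
  have lam: "8 * t \<le> \<phi>'' x" if "0 < x" "x < 1" for x
  proof -
    have "0 \<le> (2 * x - 1)\<^sup>2" by simp
    then have "4 * (x * (1 - x)) \<le> 1" by (simp add: power2_eq_square algebra_simps)
    moreover have "2 / x + 2 / (1 - x) = 2 / (x * (1 - x))" using that by (simp add: field_simps)
    ultimately have "8 \<le> 2 / x + 2 / (1 - x)" using that by (simp add: le_divide_eq)
    then show ?thesis unfolding \<phi>''_def using t by (simp only: mult.commute[of 8] mult_left_mono)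
  qed
  \<comment> \<open>The logistic function inverts u to ln u - ln (1 - u), so it names explicitly the
    points where \<open>\<phi>'\<close> takes the values -W, 0 and W.\<close>
  define \<sigma> where "\<sigma> w = 1 / (1 + exp (- w))" for w :: real
  have \<sigma>01: "0 < \<sigma> w" "\<sigma> w < 1" for w
    using exp_gt_zero[of "- w"] by (simp_all add: \<sigma>_def add_pos_pos)
  have \<sigma>_mono: "\<sigma> v \<le> \<sigma> w" if "v \<le> w" for v w
    using that by (auto simp: \<sigma>_def intro!: divide_left_mono mult_pos_pos add_pos_pos)
  have \<sigma>_inv: "ln (\<sigma> w) - ln (1 - \<sigma> w) = w" for w
  proof -
    have p: "0 < 1 + exp (- w)" by (simp add: add_pos_pos)
    then have "1 - \<sigma> w = exp (- w) / (1 + exp (- w))" by (simp add: \<sigma>_def field_simps)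
    with p show ?thesis by (simp add: \<sigma>_def ln_div)
  qed
  have \<phi>'_\<sigma>: "\<phi>' (\<sigma> ((v / t - a) / 2)) = v" for v
    using \<sigma>_inv[of "(v / t - a) / 2"] t by (simp add: \<phi>'_def field_simps)
  let ?W = "2 * sqrt (8 * t)"
  let ?b1 = "\<sigma> ((- ?W / t - a) / 2)" and ?c = "\<sigma> ((0 / t - a) / 2)" and ?b2 = "\<sigma> ((?W / t - a) / 2)"
  have ord: "?b1 \<le> ?c" "?c \<le> ?b2"
    by (rule \<sigma>_mono, use t in \<open>simp add: divide_right_mono\<close>)+
  have [measurable]: "\<phi> \<in> borel_measurable borel" unfolding \<phi>_def[abs_def] by measurable
  have n1: "cmod (iexp (\<phi> u)) = 1" for u by (rule norm_exp_i_times)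
  have "(\<lambda>u. iexp (\<phi> u)) absolutely_integrable_on {0..1}"
    by (rule integral_unif(2)[where B = 1]) (use n1 in auto)
  then have int: "(\<lambda>u. iexp (\<phi> u)) integrable_on {0..1}"
    by (rule set_lebesgue_integral_eq_integral(1))
  have "cmod (integral {0..1} (\<lambda>u. iexp (\<phi> u))) \<le> 4 / sqrt (8 * t) + e" if e: "0 < e" for e
  proof -
    \<comment> \<open>The end pieces must be short, and the middle piece must still contain all
      three points where the value of \<open>\<phi>'\<close> is prescribed.\<close>
    define p where "p = min (e / 2) ?b1"
    define q where "q = max (1 - e / 2) ?b2"
    have p: "0 < p" "p \<le> ?b1" "p \<le> e / 2" and q: "q < 1" "?b2 \<le> q" "1 - q \<le> e / 2"
      using e \<sigma>01[of "(- ?W / t - a) / 2"] \<sigma>01[of "(?W / t - a) / 2"] by (auto simp: p_def q_def max_def)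
    have pq: "p \<le> q" using p q ord by linarith
    have i: "(\<lambda>u. iexp (\<phi> u)) integrable_on {0..p}" "(\<lambda>u. iexp (\<phi> u)) integrable_on {p..1}"
        "(\<lambda>u. iexp (\<phi> u)) integrable_on {q..1}"
      by (rule integrable_subinterval_real[OF int], use p q pq in auto)+
    have "cmod (integral {p..q} (\<lambda>u. iexp (\<phi> u))) \<le> 4 / sqrt (8 * t)"
    proof (rule van_der_Corput_two_sided[where \<phi>' = \<phi>' and \<phi>'' = \<phi>''])
      show "p \<le> ?b1" "?b1 \<le> ?c" "?c \<le> ?b2" "?b2 \<le> q" by fact+
      show "\<phi>' ?b1 = - (2 * sqrt (8 * t))" "\<phi>' ?c = 0" "\<phi>' ?b2 = 2 * sqrt (8 * t)"
        by (simp_all only: \<phi>'_\<sigma>)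
      show "continuous_on {p..q} \<phi>''"
        unfolding \<phi>''_def using p q by (auto intro!: continuous_intros)
    qed (use p q t d1 d2 lam in auto)
    moreover have "cmod (integral {0..p} (\<lambda>u. iexp (\<phi> u))) \<le> e / 2"
      using cmod_integral_unimodular_le[OF i(1) _ n1] p by simp
    moreover have "cmod (integral {q..1} (\<lambda>u. iexp (\<phi> u))) \<le> e / 2"
      using cmod_integral_unimodular_le[OF i(3) _ n1] q by simp
    moreover have "integral {0..1} (\<lambda>u. iexp (\<phi> u)) = integral {0..p} (\<lambda>u. iexp (\<phi> u))
        + (integral {p..q} (\<lambda>u. iexp (\<phi> u)) + integral {q..1} (\<lambda>u. iexp (\<phi> u)))"
      using Henstock_Kurzweil_Integration.integral_combine[OF _ _ int, of p]
        Henstock_Kurzweil_Integration.integral_combine[OF _ _ i(2), of q] p q pq by simp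
    ultimately show ?thesis
      using norm_triangle_ineq[of "integral {0..p} (\<lambda>u. iexp (\<phi> u))"
          "integral {p..q} (\<lambda>u. iexp (\<phi> u)) + integral {q..1} (\<lambda>u. iexp (\<phi> u))"]
        norm_triangle_ineq[of "integral {p..q} (\<lambda>u. iexp (\<phi> u))" "integral {q..1} (\<lambda>u. iexp (\<phi> u))"]
      by simp
  qed
  then have "cmod (integral {0..1} (\<lambda>u. iexp (\<phi> u))) \<le> 4 / sqrt (8 * t)"
    by (rule field_le_epsilon)
  also have "4 / sqrt (8 * t) = sqrt 2 / sqrt t"
  proof -
    have "sqrt 8 = 2 * sqrt 2" using real_sqrt_mult[of 4 2] by simp
    moreover have "sqrt 2 * sqrt 2 = (2::real)" by simp
    ultimately show ?thesis using t by (simp add: real_sqrt_mult field_simps)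
  qed
  finally show ?thesis unfolding \<phi>_def .
qed

text \<open>For fixed subproblem values y and z, a unimodular factor exp (i t z) comes out and the
  inner integral is the Quicksort phase with slope y - z. The estimate is uniform in the slope, so
  averaging over y and z preserves it.\<close>

lemma cmod_char_qs_fixpoint_sqrt:
  assumes M: "real_distribution M" "qs_map M = M" and t: "0 < t"
  shows "cmod (char M t) \<le> sqrt 2 / sqrt t"
proof -
  interpret real_distribution M by fact
  interpret MM: pair_prob_space M M ..
  let ?I = "\<lambda>p. \<integral>u. iexp (t * (u * fst p + (1-u) * snd p + qs_g u)) \<partial>unif"
  have bound: "cmod (?I p) \<le> sqrt 2 / sqrt t" for p
  proof -
    let ?h = "\<lambda>u. iexp (t * ((fst p - snd p) * u + qs_g u))"
    have "iexp (t * (u * fst p + (1-u) * snd p + qs_g u)) = iexp (t * snd p) * ?h u" for u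
      by (simp only: exp_add[symmetric] distrib_left[symmetric] of_real_add[symmetric])
        (simp add: algebra_simps)
    then have "?I p = iexp (t * snd p) * (\<integral>u. ?h u \<partial>unif)"
      by (simp only: integral_mult_right_zero)
    also have "(\<integral>u. ?h u \<partial>unif) = integral {0..1} ?h"
      by (rule integral_unif(1)[where B = 1]) (simp_all only: norm_exp_i_times, measurable)
    finally show ?thesis
      using norm_integral_qs_phase[OF t, of "fst p - snd p"] by (simp only: norm_mult norm_exp_i_times mult_1)
  qed
  have "cmod (char M t) = cmod (\<integral>p. ?I p \<partial>(M \<Otimes>\<^sub>M M))"
    using char_qs_map(2)[OF M(1), of t] M(2) by simp
  also have "\<dots> \<le> (\<integral>p. cmod (?I p) \<partial>(M \<Otimes>\<^sub>M M))"
    by (rule integral_norm_bound)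
  also have "\<dots> \<le> sqrt 2 / sqrt t"
  proof (cases "integrable (M \<Otimes>\<^sub>M M) (\<lambda>p. cmod (?I p))")
    case True
    then show ?thesis by (rule MM.integral_le_const) (use bound in auto)
  next
    \<comment> \<open>The Bochner integral of a non-integrable function is 0 by convention, so the
      bound holds here as well.\<close>
    case False
    then show ?thesis using t by (simp add: not_integrable_integral_eq)
  qed
  finally show ?thesis .
qed

section \<open>Decay of the characteristic function\<close>

lemma integral_le_two_sqrt:
  fixes h :: "real \<Rightarrow> real"
  assumes int: "h integrable_on {0..x}" and x: "0 \<le> x"
    and le: "\<And>s. 0 < s \<Longrightarrow> s \<le> x \<Longrightarrow> h s \<le> c / sqrt s"
  shows "integral {0..x} h \<le> 2 * c * sqrt x"
proof -
  have "((\<lambda>s. c / sqrt s) has_integral 2 * c * sqrt x - 2 * c * sqrt 0) {0..x}"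
    by (rule fundamental_theorem_of_calculus_interior[OF x])
      (auto intro!: continuous_intros derivative_eq_intros
        simp: has_real_derivative_iff_has_vector_derivative[symmetric] field_simps)
  then have c: "((\<lambda>s. c / sqrt s) has_integral 2 * c * sqrt x) {0..x}" by simp
  \<comment> \<open>The majorant takes the value 0 at 0 because division by zero yields 0, and
    nothing is assumed on \<open>h 0\<close>; changing \<open>h\<close> at that one point restores a
    pointwise comparison.\<close>
  have "((\<lambda>s. if s = 0 then 0 else h s) has_integral integral {0..x} h) {0..x}"
    by (rule has_integral_spike_finite[OF _ _ integrable_integral[OF int], of "{0}"]) auto
  then show ?thesis
    by (rule has_integral_le[OF _ c]) (use le in auto)
qed

lemma integral_tail_le:
  fixes h :: "real \<Rightarrow> real"
  assumes int: "h integrable_on {T..x}" and x: "0 < T" "T \<le> x" and d: "0 \<le> d"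
    and le: "\<And>s. T \<le> s \<Longrightarrow> s \<le> x \<Longrightarrow> h s \<le> d / (s * sqrt s)"
  shows "integral {T..x} h \<le> 2 * d / sqrt T"
proof -
  have "((\<lambda>s. d / (s * sqrt s)) has_integral (- 2 * d / sqrt x) - (- 2 * d / sqrt T)) {T..x}"
    by (rule fundamental_theorem_of_calculus[OF x(2)])
      (use x in \<open>auto intro!: derivative_eq_intros
        simp: has_real_derivative_iff_has_vector_derivative[symmetric] field_simps\<close>)
  then have "integral {T..x} h \<le> (- 2 * d / sqrt x) - (- 2 * d / sqrt T)"
    by (rule has_integral_le[OF integrable_integral[OF int]]) (use le in auto)
  also have "\<dots> \<le> 2 * d / sqrt T" using x d by simp
  finally show ?thesis .
qed

text \<open>The first majorant is integrable at 0, the second at infinity. Switching between them at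
  T makes the bound independent of x, with T free for optimisation.\<close>

lemma integral_two_regimes_le:
  fixes h :: "real \<Rightarrow> real"
  assumes cont: "continuous_on UNIV h" and x: "0 \<le> x" and T: "0 < T" and cd: "0 \<le> c" "0 \<le> d"
    and le1: "\<And>s. 0 < s \<Longrightarrow> h s \<le> c / sqrt s"
    and le2: "\<And>s. 0 < s \<Longrightarrow> h s \<le> d / (s * sqrt s)"
  shows "integral {0..x} h \<le> 2 * c * sqrt T + 2 * d / sqrt T"
proof -
  have int: "h integrable_on {a..b}" for a b
    by (rule integrable_continuous_interval) (rule continuous_on_subset[OF cont], simp)
  show ?thesis
  proof (cases "x \<le> T")
    case True
    have "integral {0..x} h \<le> 2 * c * sqrt x"
      by (rule integral_le_two_sqrt[OF int x]) (use le1 in auto)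
    also have "\<dots> \<le> 2 * c * sqrt T" using True cd by (intro mult_left_mono) auto
    also have "\<dots> \<le> 2 * c * sqrt T + 2 * d / sqrt T" using T cd by simp
    finally show ?thesis .
  next
    case False
    have "integral {0..x} h = integral {0..T} h + integral {T..x} h"
      by (rule Henstock_Kurzweil_Integration.integral_combine[OF _ _ int, symmetric]) (use T False in auto)
    also have "\<dots> \<le> 2 * c * sqrt T + 2 * d / sqrt T"
      using T False cd le1 le2
      by (intro add_mono integral_le_two_sqrt integral_tail_le int) auto
    finally show ?thesis .
  qed
qed

section \<open>Successive improvement of the decay rate\<close>

text \<open>\<open>A\<close> stands for the modulus of the characteristic function. One of the two factors in the
  convolution has argument at least \<open>t / 2\<close>, so any decay rate of \<open>A\<close> improves by the factor
  \<open>1 / t\<close> times the growth of the integral of \<open>A\<close>.\<close>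

locale self_convolution_bound =
  fixes A :: "real \<Rightarrow> real"
  assumes cont: "continuous_on UNIV A"
    and nonneg: "0 \<le> A t"
    and conv: "0 < t \<Longrightarrow> A t \<le> integral {0..1} (\<lambda>u. A (u*t) * A ((1-u)*t))"
    and decay_half: "0 < t \<Longrightarrow> A t \<le> sqrt 2 / sqrt t"
begin

lemma integrable_A: "A integrable_on {a..b}"
  by (rule integrable_continuous_interval) (rule continuous_on_subset[OF cont], simp)

text \<open>By the symmetry u to 1 - u the convolution is twice its part over [0, 1/2]. There the
  second argument is at least t / 2, so its factor is at most K, and the substitution s = u t yields
  the factor 1 / t.\<close>

lemma improve_decay:
  assumes t: "0 < t" and K: "\<And>s. t / 2 \<le> s \<Longrightarrow> A s \<le> K"
  shows "A t \<le> 2 * K / t * integral {0..t/2} A"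
proof -
  let ?h = "\<lambda>u. A (u*t) * A ((1-u)*t)"
  have cA: "continuous_on S (\<lambda>u. A (v u))" if "continuous_on S v" for S :: "real set" and v
    by (rule continuous_on_compose2[OF cont that]) simp
  have ch: "continuous_on S ?h" for S
    by (intro continuous_intros cA)
  have int: "?h integrable_on {a..b}" for a b
    by (rule integrable_continuous_interval[OF ch])
  \<comment> \<open>The map u to 1 - u is composed of a reflection at 0 and a shift by 1.\<close>
  have "integral {1/2..1} ?h = integral {-1..-(1/2)} (\<lambda>u. ?h (- u))"
    by (rule Henstock_Kurzweil_Integration.integral_reflect_real[symmetric])
  also have "\<dots> = integral {0 - 1..1/2 - 1} (\<lambda>u. ?h (u + 1))"
    by (rule arg_cong2[where f = integral]) (auto simp: algebra_simps)
  also have "\<dots> = integral {0..1/2} ?h"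
    by (rule integral_shift_real_ivl)
  finally have refl: "integral {1/2..1} ?h = integral {0..1/2} ?h" .
  have "A t \<le> integral {0..1} ?h" by (rule conv[OF t])
  also have "\<dots> = integral {0..1/2} ?h + integral {1/2..1} ?h"
    by (rule Henstock_Kurzweil_Integration.integral_combine[OF _ _ int, symmetric]) auto
  also have "\<dots> = 2 * integral {0..1/2} ?h" unfolding refl by simp
  also have "integral {0..1/2} ?h \<le> integral {0..1/2} (\<lambda>u. K * A (t * u))"
  proof (rule integral_le[OF int])
    show "(\<lambda>u. K * A (t * u)) integrable_on {0..1/2}"
      by (intro integrable_continuous_interval continuous_intros cA)
    fix u :: real assume u: "u \<in> {0..1/2}"
    then have "t * (1/2) \<le> t * (1 - u)" using t by (intro mult_left_mono) auto
    then have "A ((1-u)*t) \<le> K" by (intro K) (simp add: mult.commute)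
    then show "?h u \<le> K * A (t * u)"
      using mult_right_mono[OF _ nonneg[of "u*t"]] by (metis mult.commute)
  qed
  also have "\<dots> = K * integral {0..1/2} (\<lambda>u. A (t * u))" by simp
  also have "integral {0..1/2} (\<lambda>u. A (t * u)) = 1 / t * integral {0..t/2} A"
  proof -
    have "(\<lambda>x. x / t) ` {0..t/2} = {0..1/2}"
    proof -
      have "x \<in> (\<lambda>x. x / t) ` {0..t/2}" if "x \<in> {0..1/2}" for x
        using that t by (intro image_eqI[of _ _ "x * t"]) auto
      then show ?thesis using t by (auto simp: field_simps)
    qed
    then show ?thesis using integral_stretch_real[of t 0 "t/2" A] t by simp
  qed
  finally show ?thesis by (simp add: mult_ac)
qed

lemma integral_A_le_sqrt: "0 \<le> x \<Longrightarrow> integral {0..x} A \<le> 2 * sqrt 2 * sqrt x"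
  by (rule integral_le_two_sqrt[OF integrable_A]) (use decay_half in auto)

text \<open>K is of order t^(-1/2) and the integral of A of order t^(1/2); these cancel and the
  factor 1 / t remains.\<close>

lemma decay_one:
  assumes t: "0 < t"
  shows "A t \<le> 8 / t"
proof -
  have "A t \<le> 2 * (2 / sqrt t) / t * integral {0..t/2} A"
  proof (rule improve_decay[OF t])
    fix s assume s: "t / 2 \<le> s"
    then have "A s \<le> sqrt 2 / sqrt s" using t by (intro decay_half) auto
    also have "\<dots> \<le> sqrt 2 / sqrt (t / 2)"
      using s t by (intro divide_left_mono) auto
    also have "\<dots> = 2 / sqrt t" by (simp add: real_sqrt_divide)
    finally show "A s \<le> 2 / sqrt t" .
  qed
  also have "\<dots> \<le> 2 * (2 / sqrt t) / t * (2 * sqrt 2 * sqrt (t/2))"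
    using t by (intro mult_left_mono integral_A_le_sqrt) auto
  also have "\<dots> = 8 / t" using t by (simp add: real_sqrt_divide)
  finally show ?thesis .
qed

text \<open>Now K is 16 / t by the previous rate, while the integral is still estimated by 2 sqrt
  t.\<close>

lemma decay_three_halves:
  assumes t: "0 < t"
  shows "A t \<le> 64 / (t * sqrt t)"
proof -
  have "A t \<le> 2 * (16 / t) / t * integral {0..t/2} A"
  proof (rule improve_decay[OF t])
    fix s assume s: "t / 2 \<le> s"
    then have "A s \<le> 8 / s" using t by (intro decay_one) auto
    also have "\<dots> \<le> 8 / (t / 2)"
      using s t by (intro divide_left_mono) auto
    finally show "A s \<le> 16 / t" by simp
  qed
  also have "\<dots> \<le> 2 * (16 / t) / t * (2 * sqrt 2 * sqrt (t/2))"
    using t by (intro mult_left_mono integral_A_le_sqrt) auto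
  also have "\<dots> = 64 / (t * sqrt t)"
  proof -
    have "sqrt 2 * sqrt (t/2) = sqrt t" by (simp add: real_sqrt_divide)
    moreover have "sqrt t / t = 1 / sqrt t" using t by (simp add: real_div_sqrt field_simps)
    ultimately show ?thesis using t by (simp add: field_simps)
  qed
  finally show ?thesis .
qed

lemma sqrt_2_less: "sqrt 2 < (3/2 :: real)"
  by (rule real_less_lsqrt) (auto simp: power2_eq_square)

lemma integral_A_le:
  assumes "0 \<le> x"
  shows "integral {0..x} A \<le> 40"
proof -
  \<comment> \<open>The bound in T is minimal at 64 / sqrt 2, about 45; the nearby square 49 keeps
    the arithmetic rational, giving less than 21 + 128/7 < 40.\<close>
  have "integral {0..x} A \<le> 2 * sqrt 2 * sqrt 49 + 2 * 64 / sqrt 49"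
    by (rule integral_two_regimes_le[OF cont assms]) (use decay_half decay_three_halves in auto)
  also have "sqrt 49 = (7::real)" using real_sqrt_abs[of 7] by simp
  also have "2 * sqrt 2 * 7 + 2 * 64 / 7 \<le> (40::real)" using sqrt_2_less by simp
  finally show ?thesis .
qed

text \<open>The integral of A is now bounded by 40, so a full power of t is gained at once; 16000 is
  2 * 200 * 40, where 200 rounds up 128 sqrt 2.\<close>

lemma decay_five_halves:
  assumes t: "0 < t"
  shows "A t \<le> 16000 / (t\<^sup>2 * sqrt t)"
proof -
  have "A t \<le> 2 * (200 / (t * sqrt t)) / t * integral {0..t/2} A"
  proof (rule improve_decay[OF t])
    fix s assume s: "t / 2 \<le> s"
    then have "A s \<le> 64 / (s * sqrt s)" using t by (intro decay_three_halves) auto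
    also have "\<dots> \<le> 64 / (t / 2 * sqrt (t / 2))"
      using s t by (intro divide_left_mono mult_mono mult_pos_pos) auto
    also have "\<dots> = 128 * sqrt 2 / (t * sqrt t)" by (simp add: real_sqrt_divide)
    also have "\<dots> \<le> 200 / (t * sqrt t)"
      using sqrt_2_less t by (intro divide_right_mono) auto
    finally show "A s \<le> 200 / (t * sqrt t)" .
  qed
  also have "\<dots> \<le> 2 * (200 / (t * sqrt t)) / t * 40"
    using t by (intro mult_left_mono integral_A_le) auto
  also have "\<dots> = 16000 / (t\<^sup>2 * sqrt t)" by (simp add: power2_eq_square)
  finally show ?thesis .
qed

lemma integral_t_A_le:
  assumes "0 \<le> x"
  shows "integral {0..x} (\<lambda>t. t * A t) \<le> 4054"
proof -
  \<comment> \<open>The factor t turns the rates 3/2 and 5/2 into 1/2 and 3/2. The optimal cut is at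
    16000 / 64 = 250; the square 225 gives 1920 + 32000/15 < 4054.\<close>
  have "integral {0..x} (\<lambda>t. t * A t) \<le> 2 * 64 * sqrt 225 + 2 * 16000 / sqrt 225"
  proof (rule integral_two_regimes_le[OF _ assms])
    show "continuous_on UNIV (\<lambda>t. t * A t)" by (intro continuous_intros cont)
    fix s :: real assume s: "0 < s"
    have "s * A s \<le> s * (64 / (s * sqrt s))" "s * A s \<le> s * (16000 / (s\<^sup>2 * sqrt s))"
      using s by (intro mult_left_mono decay_three_halves decay_five_halves; simp)+
    then show "s * A s \<le> 64 / sqrt s" "s * A s \<le> 16000 / (s * sqrt s)"
      using s by (simp_all add: power2_eq_square)
  qed auto
  also have "sqrt 225 = (15::real)" using real_sqrt_abs[of 15] by simp
  finally show ?thesis by simp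
qed

end

section \<open>Integrability of the characteristic function\<close>

text \<open>Monotone convergence along the intervals [-n, n] turns uniform bounds for proper
  integrals into Lebesgue integrability; evenness accounts for the factor 2.\<close>

lemma integrable_even_bounded:
  fixes h :: "real \<Rightarrow> real"
  assumes cont: "continuous_on UNIV h" and nonneg: "\<And>t. 0 \<le> h t" and even: "\<And>t. h (- t) = h t"
    and le: "\<And>x. 0 \<le> x \<Longrightarrow> integral {0..x} h \<le> C"
  shows "integrable lborel h" "(\<integral>t. h t \<partial>lborel) \<le> 2 * C"
proof -
  have [measurable]: "h \<in> borel_measurable borel"
    using cont by (rule borel_measurable_continuous_onI)
  have int: "h integrable_on {a..b}" for a b
    by (rule integrable_continuous_interval) (rule continuous_on_subset[OF cont], simp)
  have C: "0 \<le> C" using le[of 0] by simp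
  have trunc: "(\<integral>\<^sup>+t. ennreal (indicator {- real n..real n} t * h t) \<partial>lborel) \<le> ennreal (2 * C)" for n :: nat
  proof -
    have "integral {- real n..real n} h = integral {- real n..0} h + integral {0..real n} h"
      by (rule Henstock_Kurzweil_Integration.integral_combine[OF _ _ int, symmetric]) auto
    also have "integral {- real n..0} h = integral {0..real n} h"
      using Henstock_Kurzweil_Integration.integral_reflect_real[of "real n" 0 h] even by simp
    finally have eq: "integral {- real n..real n} h = 2 * integral {0..real n} h" by simp
    have "(h has_integral integral {- real n..real n} h) {- real n..real n}"
      by (rule integrable_integral[OF int])
    moreover have "(\<lambda>t. indicator {- real n..real n} t * h t) = (\<lambda>t. if t \<in> {- real n..real n} then h t else 0)"
      by (auto simp: indicator_def)
    ultimately have "((\<lambda>t. indicator {- real n..real n} t * h t) has_integral integral {- real n..real n} h) UNIV"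
      by (simp only: has_integral_restrict_UNIV)
    then have "(\<integral>\<^sup>+t. ennreal (indicator {- real n..real n} t * h t) \<partial>lborel) = ennreal (integral {- real n..real n} h)"
      by (intro nn_integral_has_integral_lborel) (auto simp: nonneg)
    then show ?thesis unfolding eq using le[of "real n"] by (simp add: ennreal_leI)
  qed
  have mono: "incseq (\<lambda>n t. ennreal (indicator {- real n..real n} t * h t))"
    by (auto simp: incseq_def le_fun_def indicator_def nonneg)
  have "ennreal (h t) = (SUP n. ennreal (indicator {- real n..real n} t * h t))" for t
  proof (rule antisym)
    obtain n :: nat where "\<bar>t\<bar> \<le> real n" using real_arch_simple by blast
    then have "ennreal (h t) = ennreal (indicator {- real n..real n} t * h t)"
      by (simp add: indicator_def abs_le_iff)
    then show "ennreal (h t) \<le> (SUP n. ennreal (indicator {- real n..real n} t * h t))"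
      by (rule SUP_upper2[OF UNIV_I, OF eq_refl])
    show "(SUP n. ennreal (indicator {- real n..real n} t * h t)) \<le> ennreal (h t)"
      by (rule SUP_least) (auto simp: indicator_def nonneg)
  qed
  then have "(\<integral>\<^sup>+t. ennreal (h t) \<partial>lborel) = (\<integral>\<^sup>+t. (SUP n. ennreal (indicator {- real n..real n} t * h t)) \<partial>lborel)"
    by simp
  also have "\<dots> = (SUP n. (\<integral>\<^sup>+t. ennreal (indicator {- real n..real n} t * h t) \<partial>lborel))"
    by (rule nn_integral_monotone_convergence_SUP[OF mono]) measurable
  also have "\<dots> \<le> ennreal (2 * C)"
    by (rule SUP_least) (rule trunc)
  finally have nn: "(\<integral>\<^sup>+t. ennreal (h t) \<partial>lborel) \<le> ennreal (2 * C)" .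
  then show i: "integrable lborel h"
    by (intro integrableI_nonneg) (auto simp: nonneg intro: le_less_trans)
  show "(\<integral>t. h t \<partial>lborel) \<le> 2 * C"
    using nn C nn_integral_eq_integral[OF i] nonneg by (simp add: ennreal_le_iff)
qed

lemma self_convolution_bound_char:
  assumes M: "real_distribution M" "qs_map M = M"
  shows "self_convolution_bound (\<lambda>t. cmod (char M t))"
proof
  interpret real_distribution M by fact
  show cont: "continuous_on UNIV (\<lambda>t. cmod (char M t))"
    by (intro continuous_intros continuous_at_imp_continuous_on) (simp add: isCont_char)
  show "0 \<le> cmod (char M t)" for t by simp
  show "0 < t \<Longrightarrow> cmod (char M t) \<le> sqrt 2 / sqrt t" for t
    by (rule cmod_char_qs_fixpoint_sqrt[OF M])
  fix t :: real
  let ?h = "\<lambda>u. char M (u*t) * char M ((1-u)*t) * iexp (t * qs_g u)"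
  have "cmod (char M t) = cmod (\<integral>u. ?h u \<partial>unif)"
    using char_qs_map(1)[OF M(1), of t] M(2) by simp
  also have "\<dots> \<le> (\<integral>u. cmod (?h u) \<partial>unif)"
    by (rule integral_norm_bound)
  also have "\<dots> = (\<integral>u. cmod (char M (u*t)) * cmod (char M ((1-u)*t)) \<partial>unif)"
    by (simp only: norm_mult norm_exp_i_times mult_1_right)
  also have "\<dots> = integral {0..1} (\<lambda>u. cmod (char M (u*t)) * cmod (char M ((1-u)*t)))"
    by (rule integral_unif(1)[where B = 1]) (auto simp: mult_le_one cmod_char_le_1)
  finally show "cmod (char M t) \<le> integral {0..1} (\<lambda>u. cmod (char M (u*t)) * cmod (char M ((1-u)*t)))" .
qed

lemma char_minus: "char M (- t) = cnj (char M t)"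
  unfolding char_def by (subst Bochner_Integration.integral_cnj[symmetric]) (simp add: exp_cnj)

lemma integrable_char_qs_fixpoint:
  assumes M: "real_distribution M" "qs_map M = M"
  shows "integrable lborel (\<lambda>t. cmod (char M t))" "(\<integral>t. cmod (char M t) \<partial>lborel) \<le> 80"
    and "integrable lborel (\<lambda>t. \<bar>t\<bar> * cmod (char M t))" "(\<integral>t. \<bar>t\<bar> * cmod (char M t) \<partial>lborel) \<le> 8108"
proof -
  interpret real_distribution M by fact
  interpret self_convolution_bound "\<lambda>t. cmod (char M t)"
    by (rule self_convolution_bound_char[OF M])
  show "integrable lborel (\<lambda>t. cmod (char M t))" "(\<integral>t. cmod (char M t) \<partial>lborel) \<le> 80"
    using integrable_even_bounded[OF cont nonneg _ integral_A_le] by (simp_all add: char_minus)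
  have c: "continuous_on UNIV (\<lambda>t. \<bar>t\<bar> * cmod (char M t))"
    by (intro continuous_intros cont)
  have le: "integral {0..x} (\<lambda>t. \<bar>t\<bar> * cmod (char M t)) \<le> 4054" if "0 \<le> x" for x
  proof -
    have "integral {0..x} (\<lambda>t. \<bar>t\<bar> * cmod (char M t)) = integral {0..x} (\<lambda>t. t * cmod (char M t))"
      by (rule integral_cong) auto
    then show ?thesis using integral_t_A_le[OF that] by simp
  qed
  show "integrable lborel (\<lambda>t. \<bar>t\<bar> * cmod (char M t))" "(\<integral>t. \<bar>t\<bar> * cmod (char M t) \<partial>lborel) \<le> 8108"
    using integrable_even_bounded[OF c _ _ le] by (simp_all add: char_minus)
qed

section \<open>Fourier transforms of integrable functions\<close>

text \<open>The sign is opposite to that of \<open>char\<close> and no constant is included, so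
  inversion reads f = \<open>fourier (char M)\<close> / (2 pi).\<close>

definition fourier :: "(real \<Rightarrow> complex) \<Rightarrow> real \<Rightarrow> complex" where
  "fourier \<psi> x = (\<integral>t. iexp (- (t * x)) * \<psi> t \<partial>lborel)"

lemma integrable_fourier:
  assumes "integrable lborel \<psi>"
  shows "integrable lborel (\<lambda>t. iexp (- (t * x)) * \<psi> t)"
proof (rule Bochner_Integration.integrable_bound[OF assms])
  have [measurable]: "\<psi> \<in> borel_measurable borel"
    using borel_measurable_integrable[OF assms] by simp
  show "(\<lambda>t. iexp (- (t * x)) * \<psi> t) \<in> borel_measurable lborel" by measurable
  show "AE t in lborel. norm (iexp (- (t * x)) * \<psi> t) \<le> norm (\<psi> t)"
    by (rule AE_I2) (simp only: norm_mult norm_exp_i_times mult_1)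
qed

lemma norm_fourier_le: "norm (fourier \<psi> x) \<le> (\<integral>t. norm (\<psi> t) \<partial>lborel)"
  unfolding fourier_def
  using integral_norm_bound[of lborel "\<lambda>t. iexp (- (t * x)) * \<psi> t"]
  by (simp only: norm_mult norm_exp_i_times mult_1)

lemma continuous_fourier:
  assumes "integrable lborel \<psi>"
  shows "isCont (fourier \<psi>) x"
  unfolding continuous_at_sequentially
proof (intro allI impI)
  fix X assume X: "X \<longlonglongrightarrow> x"
  have [measurable]: "\<psi> \<in> borel_measurable borel"
    using borel_measurable_integrable[OF assms] by simp
  show "(fourier \<psi> \<circ> X) \<longlonglongrightarrow> fourier \<psi> x"
    unfolding comp_def fourier_def
  proof (rule integral_dominated_convergence[where w = "\<lambda>t. norm (\<psi> t)"])
    show "integrable lborel (\<lambda>t. norm (\<psi> t))" using assms by simp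
    show "AE t in lborel. (\<lambda>n. iexp (- (t * X n)) * \<psi> t) \<longlonglongrightarrow> iexp (- (t * x)) * \<psi> t"
      by (rule AE_I2) (intro tendsto_intros X)
    show "AE t in lborel. norm (iexp (- (t * X n)) * \<psi> t) \<le> norm (\<psi> t)" for n
      by (rule AE_I2) (simp only: norm_mult norm_exp_i_times mult_1)
  qed measurable
qed

text \<open>Scheffe's lemma: the translates converge pointwise by continuity, and all have the same
  L1 norm by translation invariance.\<close>

lemma L1_continuous_translation:
  fixes \<psi> :: "real \<Rightarrow> complex"
  assumes int: "integrable lborel \<psi>" and cont: "continuous_on UNIV \<psi>"
  shows "((\<lambda>h. \<integral>\<^sup>+t. ennreal (norm (\<psi> (h + t) - \<psi> t)) \<partial>lborel) \<longlongrightarrow> 0) (nhds 0)"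
proof -
  let ?D = "\<lambda>h. \<integral>\<^sup>+t. ennreal (norm (\<psi> (h + t) - \<psi> t)) \<partial>lborel"
  have [measurable]: "\<psi> \<in> borel_measurable borel"
    using borel_measurable_integrable[OF int] by simp
  have "isCont ?D 0"
    unfolding continuous_at_sequentially
  proof (intro allI impI)
    fix X :: "nat \<Rightarrow> real" assume X: "X \<longlonglongrightarrow> 0"
    have "(\<lambda>n. \<integral>\<^sup>+t. ennreal (norm (\<psi> (X n + t) - \<psi> t)) \<partial>lborel) \<longlonglongrightarrow> 0"
    proof (rule Scheffe_lemma2[OF _ int])
      show "(\<lambda>t. \<psi> (X n + t)) \<in> borel_measurable lborel" for n by measurable
      show "AE t in lborel. (\<lambda>n. \<psi> (X n + t)) \<longlonglongrightarrow> \<psi> t"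
      proof (rule AE_I2)
        fix t
        have "(\<lambda>n. X n + t) \<longlonglongrightarrow> 0 + t" by (intro tendsto_intros X)
        moreover have "isCont \<psi> (0 + t)" using cont by (simp add: continuous_on_eq_continuous_at)
        ultimately show "(\<lambda>n. \<psi> (X n + t)) \<longlonglongrightarrow> \<psi> t"
          using isCont_tendsto_compose by fastforce
      qed
      show "(\<integral>\<^sup>+t. ennreal (norm (\<psi> (X n + t))) \<partial>lborel) \<le> (\<integral>\<^sup>+t. ennreal (norm (\<psi> t)) \<partial>lborel)" for n
        using nn_integral_real_affine[of "\<lambda>t. ennreal (norm (\<psi> t))" 1 "X n"] by simp
    qed
    then show "(?D \<circ> X) \<longlonglongrightarrow> ?D 0" by (simp add: comp_def)
  qed
  \<comment> \<open>The full neighbourhood filter is available because the value at 0 is itself the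
    limit; composing with pi / x then requires only convergence to 0.\<close>
  then have "(?D \<longlongrightarrow> ?D 0) (nhds 0)"
    unfolding isCont_def by (rule tendsto_at_iff_tendsto_nhds[of ?D 0, THEN iffD1])
  then show ?thesis by simp
qed

text \<open>Shifting \<open>t\<close> by \<open>pi / x\<close> changes the sign of the oscillating factor.\<close>

lemma Riemann_Lebesgue:
  assumes int: "integrable lborel \<psi>" and cont: "continuous_on UNIV \<psi>"
  shows "(fourier \<psi> \<longlongrightarrow> 0) at_infinity"
proof -
  let ?D = "\<lambda>h. \<integral>\<^sup>+t. ennreal (norm (\<psi> (h + t) - \<psi> t)) \<partial>lborel"
  have bound: "ennreal (norm (fourier \<psi> x)) \<le> ?D (pi / x)" if x: "x \<noteq> 0" for x
  proof -
    define h where "h = pi / x"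
    have int_h: "integrable lborel (\<lambda>t. \<psi> (h + t))"
      using lborel_integrable_real_affine[OF int, of 1 h] by simp
    have "iexp (- ((h + t) * x)) = - iexp (- (t * x))" for t
    proof -
      have "- ((h + t) * x) = - (t * x) + - pi"
        using x by (simp add: h_def distrib_right)
      then have "iexp (- ((h + t) * x)) = iexp (- (t * x)) * iexp (- pi)"
        by (simp only: of_real_add distrib_left exp_add)
      then show ?thesis by (simp add: exp_minus)
    qed
    then have "fourier \<psi> x = (\<integral>t. - (iexp (- (t * x)) * \<psi> (h + t)) \<partial>lborel)"
      unfolding fourier_def
      using lborel_integral_real_affine[of 1 "\<lambda>t. iexp (- (t * x)) * \<psi> t" h] by simp
    then have "fourier \<psi> x = - fourier (\<lambda>t. \<psi> (h + t)) x"
      by (simp add: fourier_def)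
    then have "2 * fourier \<psi> x = fourier \<psi> x - fourier (\<lambda>t. \<psi> (h + t)) x" by simp
    also have "\<dots> = (\<integral>t. iexp (- (t * x)) * \<psi> t - iexp (- (t * x)) * \<psi> (h + t) \<partial>lborel)"
      unfolding fourier_def
      by (rule Bochner_Integration.integral_diff[symmetric]; rule integrable_fourier; fact)
    finally have eq: "2 * fourier \<psi> x = (\<integral>t. iexp (- (t * x)) * (\<psi> t - \<psi> (h + t)) \<partial>lborel)"
      by (simp only: right_diff_distrib)
    \<comment> \<open>The factor 2 is given away, since only convergence to 0 matters.\<close>
    have "ennreal (norm (fourier \<psi> x)) \<le> ennreal (norm (2 * fourier \<psi> x))"
      by (rule ennreal_leI) (simp add: norm_mult)
    also have "\<dots> \<le> (\<integral>\<^sup>+t. ennreal (norm (iexp (- (t * x)) * (\<psi> t - \<psi> (h + t)))) \<partial>lborel)"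
      unfolding eq
      by (rule integral_norm_bound_ennreal, rule integrable_fourier) (use int int_h in simp)
    also have "\<dots> = ?D h"
      by (simp only: norm_mult norm_exp_i_times mult_1 norm_minus_commute)
    finally show ?thesis unfolding h_def .
  qed
  have "((\<lambda>x::real. pi / x) \<longlongrightarrow> 0) at_infinity"
    by (rule tendsto_divide_0[OF tendsto_const]) (rule filterlim_ident)
  then have "((\<lambda>x. ?D (pi / x)) \<longlongrightarrow> 0) at_infinity"
    by (rule filterlim_compose[OF L1_continuous_translation[OF int cont]])
  then have "((\<lambda>x. ennreal (norm (fourier \<psi> x))) \<longlongrightarrow> 0) at_infinity"
  proof (rule tendsto_sandwich[OF _ _ tendsto_const, rotated 2])
    show "\<forall>\<^sub>F x in at_infinity. ennreal (norm (fourier \<psi> x)) \<le> ?D (pi / x)"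
      unfolding eventually_at_infinity by (intro exI[of _ 1]) (auto intro!: bound)
  qed simp
  then have "((\<lambda>x. norm (fourier \<psi> x)) \<longlongrightarrow> 0) at_infinity"
    unfolding ennreal_0[symmetric] by (intro tendsto_ennrealD) auto
  then show ?thesis by (rule tendsto_norm_zero_cancel)
qed

section \<open>Differentiation under the integral sign\<close>

lemma norm_vector_derivative_bound:
  fixes g :: "real \<Rightarrow> 'a::real_normed_vector"
  assumes d: "\<And>x. (g has_vector_derivative g' x) (at x)" and b: "\<And>x. norm (g' x) \<le> B"
  shows "norm (g y - g x) \<le> B * \<bar>y - x\<bar>"
proof -
  have "norm (g y - g x) \<le> B * norm (y - x)"
  proof (rule differentiable_bound[of UNIV g "\<lambda>x h. h *\<^sub>R g' x"])
    fix x :: real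
    show "(g has_derivative (\<lambda>h. h *\<^sub>R g' x)) (at x within UNIV)"
      using d[of x] by (simp add: has_vector_derivative_def)
    show "onorm (\<lambda>h. h *\<^sub>R g' x) \<le> B"
      by (rule onorm_le) (use mult_left_mono[OF b[of x] abs_ge_zero] in \<open>simp add: mult.commute\<close>)
  qed auto
  then show ?thesis by simp
qed

text \<open>The mean value inequality bounds the normalised Taylor remainders by
  \<open>2 * w t\<close>, so dominated convergence applies along every sequence of increments
  tending to 0.\<close>

lemma has_vector_derivative_lebesgue_integral:
  fixes K k :: "'a \<Rightarrow> real \<Rightarrow> 'b::{banach, second_countable_topology}"
  assumes int: "\<And>x. integrable M (\<lambda>t. K t x)" and w: "integrable M w"
    and meas: "\<And>x. (\<lambda>t. k t x) \<in> borel_measurable M"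
    and d: "\<And>t x. ((\<lambda>x. K t x) has_vector_derivative k t x) (at x)"
    and b: "\<And>t x. norm (k t x) \<le> w t"
  shows "((\<lambda>x. \<integral>t. K t x \<partial>M) has_vector_derivative (\<integral>t. k t x \<partial>M)) (at x)"
proof -
  have intk: "integrable M (\<lambda>t. k t x)" for x
    by (rule Bochner_Integration.integrable_bound[OF w meas])
      (rule AE_I2, simp add: order_trans[OF b abs_ge_self])
  have norm_div: "norm (v /\<^sub>R norm h) = norm v / norm h" for v :: 'b and h :: real
    by (simp add: divide_inverse mult.commute)
  let ?R = "\<lambda>h t. (K t (x + h) - K t x - h *\<^sub>R k t x) /\<^sub>R norm h"
  have R: "(\<integral>t. ?R h t \<partial>M) = ((\<integral>t. K t (x + h) \<partial>M) - (\<integral>t. K t x \<partial>M) - h *\<^sub>R (\<integral>t. k t x \<partial>M)) /\<^sub>R norm h" for h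
    using int intk by simp
  have "((\<lambda>h. \<integral>t. ?R h t \<partial>M) \<longlongrightarrow> (\<integral>t. 0 \<partial>M)) (at 0)"
    unfolding tendsto_at_iff_sequentially comp_def
  proof (intro allI impI)
    fix X :: "nat \<Rightarrow> real" assume X0: "\<forall>i. X i \<in> UNIV - {0}" and X: "X \<longlonglongrightarrow> 0"
    have F: "filterlim X (at 0) sequentially"
      using X X0 by (auto simp: filterlim_at)
    show "(\<lambda>n. \<integral>t. ?R (X n) t \<partial>M) \<longlonglongrightarrow> (\<integral>t. 0 \<partial>M)"
    proof (rule integral_dominated_convergence[where w = "\<lambda>t. 2 * w t"])
      show "integrable M (\<lambda>t. 2 * w t)" using w by simp
      show "(\<lambda>t. ?R (X n) t) \<in> borel_measurable M" for n
        using int intk by (intro borel_measurable_integrable) simp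
      show "AE t in M. (\<lambda>n. ?R (X n) t) \<longlonglongrightarrow> 0"
      proof (rule AE_I2)
        fix t
        have "((\<lambda>h. norm (K t (x + h) - K t x - h *\<^sub>R k t x) / norm h) \<longlongrightarrow> 0) (at 0)"
          using d[of t x] by (simp add: has_vector_derivative_def has_derivative_at)
        then have "((\<lambda>h. norm (?R h t)) \<longlongrightarrow> 0) (at 0)"
          by (simp only: norm_div)
        from tendsto_norm_zero_cancel[OF this] F show "(\<lambda>n. ?R (X n) t) \<longlonglongrightarrow> 0"
          by (rule filterlim_compose)
      qed
      show "AE t in M. norm (?R (X n) t) \<le> 2 * w t" for n
      proof (rule AE_I2)
        fix t
        have "norm (K t (x + X n) - K t x - X n *\<^sub>R k t x) \<le> norm (K t (x + X n) - K t x) + norm (X n *\<^sub>R k t x)"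
          by (rule norm_triangle_ineq4)
        also have "\<dots> \<le> w t * \<bar>x + X n - x\<bar> + \<bar>X n\<bar> * w t"
          by (intro add_mono norm_vector_derivative_bound[OF d b]) (simp add: b mult_left_mono)
        also have "\<dots> = 2 * w t * \<bar>X n\<bar>" by simp
        finally show "norm (?R (X n) t) \<le> 2 * w t"
          unfolding norm_div using X0 by (simp add: divide_le_eq)
      qed
    qed simp
  qed
  then have "((\<lambda>h. norm (\<integral>t. ?R h t \<partial>M)) \<longlongrightarrow> 0) (at 0)"
    by (simp only: integral_zero tendsto_norm_zero_iff)
  moreover have "norm (\<integral>t. ?R h t \<partial>M) =
      norm ((\<integral>t. K t (x + h) \<partial>M) - (\<integral>t. K t x \<partial>M) - h *\<^sub>R (\<integral>t. k t x \<partial>M)) / norm h" for h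
    unfolding R norm_div ..
  ultimately show ?thesis
    by (simp add: has_vector_derivative_def has_derivative_at bounded_linear_scaleR_left)
qed

lemma has_vector_derivative_iexp_minus:
  "((\<lambda>x. iexp (- (t * x))) has_vector_derivative - (\<i> * t) * iexp (- (t * x))) (at x)"
proof -
  have "((\<lambda>x. - (t * x)) has_real_derivative - t) (at x)"
    by (auto intro!: derivative_eq_intros)
  from has_vector_derivative_iexp_compose[OF this] show ?thesis
    by (simp add: scaleR_conv_of_real mult_ac)
qed

lemma has_vector_derivative_fourier:
  assumes int: "integrable lborel \<psi>" and intt: "integrable lborel (\<lambda>t. \<bar>t\<bar> * norm (\<psi> t))"
  shows "(fourier \<psi> has_vector_derivative fourier (\<lambda>t. - (\<i> * t) * \<psi> t) x) (at x)"
proof -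
  have [measurable]: "\<psi> \<in> borel_measurable borel"
    using borel_measurable_integrable[OF int] by simp
  have "((\<lambda>x. \<integral>t. iexp (- (t * x)) * \<psi> t \<partial>lborel) has_vector_derivative
      (\<integral>t. iexp (- (t * x)) * (- (\<i> * t) * \<psi> t) \<partial>lborel)) (at x)"
  proof (rule has_vector_derivative_lebesgue_integral[OF integrable_fourier[OF int] intt])
    fix t x
    show "((\<lambda>x. iexp (- (t * x)) * \<psi> t) has_vector_derivative
        iexp (- (t * x)) * (- (\<i> * t) * \<psi> t)) (at x)"
      by (rule has_vector_derivative_eq_rhs[OF has_vector_derivative_mult_left[OF has_vector_derivative_iexp_minus]])
        (simp only: mult_ac)
    have "norm (iexp (- (t * x)) * (- (\<i> * t) * \<psi> t)) = \<bar>t\<bar> * norm (\<psi> t)"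
      by (simp only: norm_mult norm_exp_i_times mult_1 norm_minus_cancel norm_ii norm_of_real)
    then show "norm (iexp (- (t * x)) * (- (\<i> * t) * \<psi> t)) \<le> \<bar>t\<bar> * norm (\<psi> t)" by simp
  next
    show "(\<lambda>t. iexp (- (t * x)) * (- (\<i> * t) * \<psi> t)) \<in> borel_measurable lborel" for x
      by measurable
  qed
  then show ?thesis unfolding fourier_def[abs_def] .
qed

section \<open>Inversion and the bounds\<close>

lemma norm_iexp_diff_le: "cmod (iexp x - iexp y) \<le> \<bar>x - y\<bar>"
proof -
  have "iexp x - iexp y = iexp y * (iexp (x - y) - 1)"
    by (simp add: right_diff_distrib exp_add[symmetric])
  then have "cmod (iexp x - iexp y) = cmod (iexp (x - y) - 1)"
    by (simp only: norm_mult norm_exp_i_times mult_1)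
  also have "\<dots> \<le> \<bar>x - y\<bar>"
    using iexp_approx1[of "x - y" 0] by simp
  finally show ?thesis .
qed

text \<open>The kernel vanishes at \<open>t = 0\<close> because of \<open>x / 0 = 0\<close>; only almost every \<open>t\<close> matters.\<close>

definition inversion_kernel :: "real \<Rightarrow> real \<Rightarrow> real \<Rightarrow> complex" where
  "inversion_kernel a b t = (iexp (- (t * a)) - iexp (- (t * b))) / (\<i> * t)"

lemma norm_inversion_kernel_le: "cmod (inversion_kernel a b t) \<le> \<bar>b - a\<bar>"
proof (cases "t = 0")
  case False
  have "cmod (iexp (- (t * a)) - iexp (- (t * b))) \<le> \<bar>t\<bar> * \<bar>b - a\<bar>"
    using norm_iexp_diff_le[of "- (t * a)" "- (t * b)"]
    by (simp add: abs_mult[symmetric] right_diff_distrib)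
  then have "cmod (iexp (- (t * a)) - iexp (- (t * b))) / \<bar>t\<bar> \<le> \<bar>b - a\<bar>"
    using False by (simp add: divide_le_eq mult.commute)
  then show ?thesis
    by (simp only: inversion_kernel_def norm_divide norm_mult norm_ii norm_of_real mult_1)
qed (simp add: inversion_kernel_def)

lemma inversion_kernel_measurable [measurable]: "inversion_kernel a b \<in> borel_measurable borel"
  unfolding inversion_kernel_def[abs_def] by measurable

text \<open>Differentiating in the right endpoint removes the denominator, which turns the inversion
  formula for interval probabilities into one for the density.\<close>

lemma has_vector_derivative_inversion_kernel:
  "((\<lambda>b. inversion_kernel a b t) has_vector_derivative (if t = 0 then 0 else iexp (- (t * b)))) (at b)"
proof (cases "t = 0")
  case False
  have "((\<lambda>b. (iexp (- (t * a)) - iexp (- (t * b))) * (1 / (\<i> * t))) has_vector_derivative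
      (0 - - (\<i> * t) * iexp (- (t * b))) * (1 / (\<i> * t))) (at b)"
    by (intro has_vector_derivative_mult_left has_vector_derivative_diff
        has_vector_derivative_const has_vector_derivative_iexp_minus)
  moreover have "(0 - - (\<i> * t) * iexp (- (t * b))) * (1 / (\<i> * t)) = iexp (- (t * b))"
    using False by simp
  ultimately show ?thesis
    using False unfolding inversion_kernel_def by simp
qed (simp add: inversion_kernel_def)

lemma (in real_distribution) integrable_inversion_kernel:
  assumes int: "integrable lborel (\<lambda>t. cmod (char M t))"
  shows "integrable lborel (\<lambda>t. inversion_kernel a b t * char M t)"
proof (rule Bochner_Integration.integrable_bound)
  show "integrable lborel (\<lambda>t. \<bar>b - a\<bar> * cmod (char M t))" using int by simp
  show "AE t in lborel. norm (inversion_kernel a b t * char M t) \<le> norm (\<bar>b - a\<bar> * cmod (char M t))"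
    by (rule AE_I2) (simp add: norm_mult mult_right_mono norm_inversion_kernel_le)
qed measurable

text \<open>Levy inversion gives a limit of truncated integrals. With an integrable characteristic
  function and a bounded kernel, dominated convergence identifies it as a single absolutely
  convergent integral.\<close>

lemma (in real_distribution) measure_Ioc_eq_integral_char:
  assumes int: "integrable lborel (\<lambda>t. cmod (char M t))" and ab: "a \<le> b"
    and null: "measure M {a} = 0" "measure M {b} = 0"
  shows "complex_of_real (measure M {a<..b}) = 1 / (2 * pi) * (\<integral>t. inversion_kernel a b t * char M t \<partial>lborel)"
proof -
  let ?g = "\<lambda>t. inversion_kernel a b t * char M t"
  have g: "integrable lborel ?g" by (rule integrable_inversion_kernel[OF int])
  have "(\<lambda>n. \<integral>t. indicator {- real n..real n} t *\<^sub>R ?g t \<partial>lborel) \<longlonglongrightarrow> (\<integral>t. ?g t \<partial>lborel)"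
  proof (rule integral_dominated_convergence[where w = "\<lambda>t. norm (?g t)"])
    show "integrable lborel (\<lambda>t. norm (?g t))" using g by simp
    show "AE t in lborel. (\<lambda>n. indicator {- real n..real n} t *\<^sub>R ?g t) \<longlonglongrightarrow> ?g t"
    proof (rule AE_I2, rule tendsto_eventually)
      fix t
      obtain N :: nat where N: "\<bar>t\<bar> \<le> real N" using real_arch_simple by blast
      show "\<forall>\<^sub>F n in sequentially. indicator {- real n..real n} t *\<^sub>R ?g t = ?g t"
      proof (rule eventually_sequentiallyI[of N])
        fix n assume "N \<le> n"
        with N have "t \<in> {- real n..real n}" by auto
        then show "indicator {- real n..real n} t *\<^sub>R ?g t = ?g t" by simp
      qed
    qed
    show "AE t in lborel. norm (indicator {- real n..real n} t *\<^sub>R ?g t) \<le> norm (?g t)" for n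
      by (rule AE_I2) (simp add: indicator_def)
  qed measurable
  moreover have "(\<integral>t. indicator {- real n..real n} t *\<^sub>R ?g t \<partial>lborel) = (CLBINT t=-real n..real n. ?g t)" for n
    by (simp add: interval_integral_Icc set_lebesgue_integral_def)
  ultimately have "(\<lambda>n. CLBINT t=-real n..real n. ?g t) \<longlonglongrightarrow> (\<integral>t. ?g t \<partial>lborel)"
    by simp
  then have "(\<lambda>n. 1 / (2 * pi) * (CLBINT t=-real n..real n. ?g t)) \<longlonglongrightarrow> 1 / (2 * pi) * (\<integral>t. ?g t \<partial>lborel)"
    by (rule tendsto_mult_left)
  moreover have "(\<lambda>n. 1 / (2 * pi) * (CLBINT t=-real n..real n. ?g t)) \<longlonglongrightarrow> complex_of_real (measure M {a<..b})"
    using Levy_Inversion[OF ab null] unfolding inversion_kernel_def by simp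
  ultimately show ?thesis by (rule LIMSEQ_unique[symmetric])
qed

text \<open>The probability of (a, b] is differentiated in b in two ways: the fundamental theorem
  gives f, and differentiation under the integral gives the Fourier transform. Continuity of f makes
  the identity hold at every point.\<close>

lemma density_eq_fourier_char:
  fixes f :: "real \<Rightarrow> real"
  assumes M: "real_distribution M" "M = density lborel (\<lambda>x. ennreal (f x))"
    and cont: "continuous_on UNIV f" and nonneg: "\<And>x. 0 \<le> f x"
    and int: "integrable lborel (\<lambda>t. cmod (char M t))"
  shows "complex_of_real (f x) = 1 / (2 * pi) * fourier (char M) x"
proof -
  interpret real_distribution M by fact
  have [measurable]: "f \<in> borel_measurable borel"
    using cont by (rule borel_measurable_continuous_onI)
  have null: "measure M {y} = 0" for y
    unfolding M(2) measure_def by (subst emeasure_density) (auto simp: nn_integral_indicator_singleton')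
  have fi: "f integrable_on {a..b}" for a b
    by (rule integrable_continuous_interval) (rule continuous_on_subset[OF cont], simp)
  have meas: "measure M {a<..b} = integral {a..b} f" if "a \<le> b" for a b
  proof -
    have "((\<lambda>t. indicator {a<..b} t * f t) has_integral integral {a..b} f) UNIV"
    proof -
      have "((\<lambda>t. if t \<in> {a..b} then f t else 0) has_integral integral {a..b} f) UNIV"
        using integrable_integral[OF fi] by (simp only: has_integral_restrict_UNIV)
      then show ?thesis
        by (rule has_integral_spike_finite[of "{a}", rotated 2]) (auto simp: indicator_def)
    qed
    then have "(\<integral>\<^sup>+t. ennreal (indicator {a<..b} t * f t) \<partial>lborel) = ennreal (integral {a..b} f)"
      by (intro nn_integral_has_integral_lborel) (auto simp: nonneg)
    moreover have "emeasure M {a<..b} = (\<integral>\<^sup>+t. ennreal (indicator {a<..b} t * f t) \<partial>lborel)"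
      unfolding M(2) by (subst emeasure_density) (auto intro!: nn_integral_cong simp: indicator_def)
    ultimately show ?thesis
      by (simp add: measure_def integral_nonneg fi nonneg)
  qed
  \<comment> \<open>Any base point strictly below x serves, so that both expressions agree on a
    neighbourhood of x.\<close>
  define a where "a = x - 1"
  let ?I = "\<lambda>b. \<integral>t. inversion_kernel a b t * char M t \<partial>lborel"
  have "(?I has_vector_derivative
      (\<integral>t. (if t = 0 then 0 else iexp (- (t * x))) * char M t \<partial>lborel)) (at x)"
  proof (rule has_vector_derivative_lebesgue_integral[OF integrable_inversion_kernel[OF int] int])
    fix t x
    show "((\<lambda>b. inversion_kernel a b t * char M t) has_vector_derivative
        (if t = 0 then 0 else iexp (- (t * x))) * char M t) (at x)"
      by (intro has_vector_derivative_mult_left has_vector_derivative_inversion_kernel)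
    have "cmod (if t = 0 then 0 else iexp (- (t * x))) \<le> 1"
      by (simp only: norm_exp_i_times norm_zero split: if_split) simp
    then show "cmod ((if t = 0 then 0 else iexp (- (t * x))) * char M t) \<le> cmod (char M t)"
      by (simp only: norm_mult mult_left_le_one_le norm_ge_zero)
  next
    show "(\<lambda>t. (if t = 0 then 0 else iexp (- (t * x))) * char M t) \<in> borel_measurable lborel" for x
      by measurable
  qed
  moreover have "(\<integral>t. (if t = 0 then 0 else iexp (- (t * x))) * char M t \<partial>lborel) = fourier (char M) x"
    unfolding fourier_def
  proof (rule integral_cong_AE)
    show "AE t in lborel. (if t = 0 then 0 else iexp (- (t * x))) * char M t = iexp (- (t * x)) * char M t"
      using AE_lborel_singleton[of 0] by eventually_elim simp
  qed measurable
  ultimately have "(?I has_vector_derivative fourier (char M) x) (at x)" by simp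
  then have "((\<lambda>b. 1 / (2 * pi) * ?I b) has_vector_derivative 1 / (2 * pi) * fourier (char M) x) (at x)"
    by (rule has_vector_derivative_mult_right)
  then have d1: "((\<lambda>b. complex_of_real (integral {a..b} f)) has_vector_derivative
      1 / (2 * pi) * fourier (char M) x) (at x)"
  proof (rule has_vector_derivative_transform_within_open[of _ _ _ "{a<..}"])
    fix b assume b: "b \<in> {a<..}"
    then show "1 / (2 * pi) * ?I b = complex_of_real (integral {a..b} f)"
      using measure_Ioc_eq_integral_char[OF int _ null null, of a b] meas[of a b] by simp
  qed (auto simp: a_def)
  have "((\<lambda>b. integral {a..b} f) has_vector_derivative f x) (at x within {a..x + 1})"
    by (rule integral_has_vector_derivative) (auto simp: a_def intro: continuous_on_subset[OF cont])
  then have "((\<lambda>b. integral {a..b} f) has_vector_derivative f x) (at x)"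
    by (simp add: at_within_Icc_at a_def)
  then have "((\<lambda>b. complex_of_real (integral {a..b} f)) has_vector_derivative complex_of_real (f x)) (at x)"
    by (rule bounded_linear.has_vector_derivative[OF bounded_linear_of_real])
  from vector_derivative_unique_at[OF this d1] show ?thesis .
qed

lemma attains_max_at_infinity_zero:
  fixes h :: "real \<Rightarrow> real"
  assumes cont: "continuous_on UNIV h" and lim: "(h \<longlongrightarrow> 0) at_infinity" and nonneg: "\<And>x. 0 \<le> h x"
  shows "\<exists>x0. \<forall>x. h x \<le> h x0"
proof (cases "\<exists>y. 0 < h y")
  case False
  then show ?thesis using nonneg by (metis antisym not_less)
next
  case True
  then obtain y where y: "0 < h y" ..
  have "\<forall>\<^sub>F x in at_infinity. h x < h y"
    by (rule order_tendstoD(2)[OF lim y])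
  then obtain B where B: "\<And>x. B \<le> \<bar>x\<bar> \<Longrightarrow> h x < h y"
    by (auto simp: eventually_at_infinity)
  \<comment> \<open>Including the modulus of y ensures that the maximum over the compact interval is
    at least \<open>h y\<close>, hence above all values outside.\<close>
  define R where "R = max B \<bar>y\<bar>"
  have "\<exists>x0\<in>{-R..R}. \<forall>x\<in>{-R..R}. h x \<le> h x0"
    by (rule continuous_attains_sup)
      (auto simp: R_def intro: continuous_on_subset[OF cont])
  then obtain x0 where x0: "\<And>x. x \<in> {-R..R} \<Longrightarrow> h x \<le> h x0" by blast
  have "y \<in> {-R..R}" by (auto simp: R_def)
  then have "h y \<le> h x0" by (rule x0)
  have "h x \<le> h x0" for x
  proof (cases "x \<in> {-R..R}")
    case False
    then have "B \<le> \<bar>x\<bar>" by (auto simp: R_def)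
    with B[of x] \<open>h y \<le> h x0\<close> show ?thesis by simp
  qed (rule x0)
  then show ?thesis by blast
qed

section \<open>Bounds and attained maxima for the density and its derivative\<close>

theorem theorem3p3:
  fixes f :: "real \<Rightarrow> real"
  assumes "continuous_on UNIV f"
    and "\<forall>x. 0 \<le> f x"
    and "quicksort_law = density lborel (\<lambda>x. ennreal (f x))"
  shows "(\<exists>x0. \<forall>x. f x \<le> f x0) \<and> (\<forall>x. f x < 16)
       \<and> (\<forall>x. f differentiable (at x))
       \<and> (\<exists>x0. \<forall>x. \<bar>deriv f x\<bar> \<le> \<bar>deriv f x0\<bar>) \<and> (\<forall>x. \<bar>deriv f x\<bar> < 2466)"
proof -
  have law: "is_qs_law quicksort_law" by (rule is_qs_law_quicksort_law)
  then interpret real_distribution quicksort_law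
    by (auto simp: is_qs_law_def real_distribution_def real_distribution_axioms_def)
  have M: "real_distribution quicksort_law" "qs_map quicksort_law = quicksort_law"
    using law by (auto simp: is_qs_law_def intro: real_distribution_axioms)
  note int = integrable_char_qs_fixpoint[OF M]
  define \<phi> where "\<phi> = char quicksort_law"
  \<comment> \<open>Differentiating exp (-i t x) in x brings down the factor -i t, so the Fourier
    transform of \<open>\<psi>\<close> is the derivative of that of \<open>\<phi>\<close>.\<close>
  define \<psi> where "\<psi> t = - (\<i> * complex_of_real t) * \<phi> t" for t
  have [measurable]: "\<phi> \<in> borel_measurable borel" unfolding \<phi>_def by (rule char_measurable)
  have c\<phi>: "continuous_on UNIV \<phi>"
    unfolding \<phi>_def by (rule continuous_at_imp_continuous_on) (simp add: isCont_char)
  then have c\<psi>: "continuous_on UNIV \<psi>" unfolding \<psi>_def by (intro continuous_intros)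
  then have [measurable]: "\<psi> \<in> borel_measurable borel"
    by (rule borel_measurable_continuous_onI)
  have n\<psi>: "norm (\<psi> t) = \<bar>t\<bar> * norm (\<phi> t)" for t
    by (simp only: \<psi>_def norm_mult norm_minus_cancel norm_ii norm_of_real mult_1)
  have i\<phi>: "integrable lborel \<phi>"
    using int(1) unfolding \<phi>_def by (rule integrable_norm_cancel) measurable
  have i\<psi>: "integrable lborel \<psi>"
    by (rule integrable_norm_cancel) (use int(3) in \<open>simp_all add: n\<psi> \<phi>_def\<close>)
  have f: "complex_of_real (f x) = 1 / (2 * pi) * fourier \<phi> x" for x
    unfolding \<phi>_def by (rule density_eq_fourier_char[OF M(1) assms(3,1) _ int(1)]) (use assms(2) in simp)
  define f' where "f' x = Re (1 / (2 * pi) * fourier \<psi> x)" for x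
  have f_eq: "f x = Re (1 / (2 * pi) * fourier \<phi> x)" for x
    by (simp only: f[symmetric] Re_complex_of_real)
  have d: "(f has_real_derivative f' x) (at x)" for x
  proof -
    have "(fourier \<phi> has_vector_derivative fourier \<psi> x) (at x)"
      unfolding \<psi>_def by (rule has_vector_derivative_fourier[OF i\<phi>]) (use int(3) in \<open>simp add: \<phi>_def\<close>)
    then have "((\<lambda>x. 1 / (2 * pi) * fourier \<phi> x) has_vector_derivative 1 / (2 * pi) * fourier \<psi> x) (at x)"
      by (rule has_vector_derivative_mult_right)
    then show ?thesis
      unfolding f_eq[abs_def] f'_def by (simp only: has_vector_derivative_complex_iff)
  qed
  then have deriv: "deriv f = f'" by (intro ext DERIV_imp_deriv)
  have Re_le: "\<bar>Re (1 / (2 * pi) * z)\<bar> \<le> 1 / (2 * pi) * norm z" for z :: complex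
    using abs_Re_le_cmod[of "1 / (2 * pi) * z"] by (simp add: norm_mult norm_divide)
  \<comment> \<open>Only pi > 3 enters: 80 < 6 * 16 = 96 and 8108 < 6 * 2466 = 14796.\<close>
  have bound: "\<bar>Re (1 / (2 * pi) * fourier h x)\<bar> < C"
    if "(\<integral>t. norm (h t) \<partial>lborel) \<le> K" "K < 6 * C" "0 < C" for h x C K
  proof -
    have "norm (fourier h x) \<le> K" using norm_fourier_le that(1) by (rule order_trans)
    also have "K < 2 * pi * C"
    proof -
      have "6 * C < 2 * pi * C" using pi_gt3 that(3) by simp
      then show ?thesis by (rule less_trans[OF that(2)])
    qed
    finally have "1 / (2 * pi) * norm (fourier h x) < C"
      using pi_gt_zero by (simp add: field_simps)
    with Re_le[of "fourier h x"] show ?thesis by simp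
  qed
  have lim: "((\<lambda>x. \<bar>Re (1 / (2 * pi) * fourier h x)\<bar>) \<longlongrightarrow> 0) at_infinity"
    if "integrable lborel h" "continuous_on UNIV h" for h
  proof -
    have "((\<lambda>x. \<bar>Re (1 / (2 * pi) * fourier h x)\<bar>) \<longlongrightarrow> \<bar>Re (1 / (2 * pi) * (0 :: complex))\<bar>) at_infinity"
      by (intro tendsto_intros Riemann_Lebesgue that)
    then show ?thesis by simp
  qed
  have cont: "continuous_on UNIV (\<lambda>x. \<bar>Re (1 / (2 * pi) * fourier h x)\<bar>)" if "integrable lborel h" for h
    by (intro continuous_intros continuous_at_imp_continuous_on ballI continuous_fourier that)
  \<comment> \<open>Stated for absolute values to serve both cases: for f the modulus drops by
    nonnegativity, and for the derivative it is the quantity in question.\<close>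
  have max: "\<exists>x0. \<forall>x. \<bar>Re (1 / (2 * pi) * fourier h x)\<bar> \<le> \<bar>Re (1 / (2 * pi) * fourier h x0)\<bar>"
    if "integrable lborel h" "continuous_on UNIV h" for h
    by (rule attains_max_at_infinity_zero[OF cont lim]) (use that in auto)
  have abs_f: "\<bar>f x\<bar> = f x" for x using assms(2) by simp
  show ?thesis
    unfolding deriv
  proof (intro conjI allI)
    show "\<exists>x0. \<forall>x. f x \<le> f x0"
      using max[OF i\<phi> c\<phi>] by (simp only: f_eq[symmetric] abs_f)
    show "f x < 16" for x
    proof -
      have "\<bar>f x\<bar> < 16"
        unfolding f_eq by (rule bound[of \<phi> 80]) (use int(2) in \<open>simp_all add: \<phi>_def\<close>)
      then show ?thesis by (simp only: abs_f)
    qed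
    show "f differentiable (at x)" for x
      using d real_differentiable_def by blast
    show "\<exists>x0. \<forall>x. \<bar>f' x\<bar> \<le> \<bar>f' x0\<bar>"
      unfolding f'_def by (rule max[OF i\<psi> c\<psi>])
    show "\<bar>f' x\<bar> < 2466" for x
      unfolding f'_def by (rule bound[of \<psi> 8108]) (use int(4) in \<open>simp_all add: n\<psi> \<phi>_def\<close>)
  qed
qed

end
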